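(* Let $K$ be a finite-dimensional $1$-connected complex Lie group with simple Lie algebra $\mathfrak{k}$, let $\Sigma$ be a compact connected Riemann surface, $p_1,\dots,p_k\in\Sigma$ distinct points with $k\ge1$, and $\Sigma_k=\Sigma\setminus\{p_1,\dots,p_k\}$. Let $\mathcal{U}=\{U_i\}$ be a good open cover of $\Sigma_k$. Let $\lambda\in\mathbb{C}$, let $D=\lambda\partial+\xi\in H_\lambda$, and consider the equation $$\lambda(\partial\psi_i)\psi_i^{-1}+\xi=0.$$ Then solutions $\psi_i$ exist on $U_i$, and the functions $\phi_{ij}:=\psi_i^{-1}\psi_j:U_{ij}=U_i\cap U_j\to K$ determine transition functions of a holomorphic principal $K$-bundle on $\Sigma_k$. Furthermore, the functions $\phi_{ij}$ are constant, thus the bundle is flat.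
   Context: For $\lambda\in\mathbb{C}$, $H_\lambda$ is the hyperplane of all operators $\lambda\partial+\xi$ with this fixed $\lambda$, where $\xi\in\Omega^1(\Sigma_k,\mathfrak{k})$ is a holomorphic $\mathfrak{k}$-valued $1$-form on $\Sigma_k$; it lies in the space of all operators $\lambda\partial+\xi$ with $\lambda\in\mathbb{C}$ and $\xi\in\Omega^1(\Sigma_k,\mathfrak{k})$. A good open cover is one all of whose nonempty finite intersections are contractible. The unknowns $\psi_i:U_i\to K$ are holomorphic maps, $\partial$ denotes the holomorphic exterior differential, and $(\partial\psi)\psi^{-1}$ denotes the right logarithmic derivative of a $K$-valued holomorphic map, a holomorphic $\mathfrak{k}$-valued $1$-form.
   Formalization: Existence of the solutions, constancy of the φ_ij and flatness are stated for λ ≠ 0 only: for λ = 0 the equation reads ξ = 0, so there is no solution where ξ ≠ 0, and if ξ = 0 every holomorphic ψ_i solves it and φ_ij need not be constant. *)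

theory Defs
  imports "HOL-Analysis.Analysis" "HOL-Algebra.Group"
begin

section \<open>Charts and atlases\<close>

text \<open>A chart is a pair of its domain and its coordinate map; the values of the coordinate map
  outside the domain are irrelevant.\<close>

type_synonym ('a, 'e) chart = "'a set \<times> ('a \<Rightarrow> 'e)"

definition chart_inv :: "('a, 'e) chart \<Rightarrow> 'e \<Rightarrow> 'a" where
  "chart_inv c = inv_into (fst c) (snd c)"

text \<open>The predicate \<open>H S f\<close> says which coordinate changes \<open>f\<close> with domain \<open>S\<close> are admitted. Atlases
  need not be maximal.\<close>

definition atlas ::
  "('e set \<Rightarrow> ('e \<Rightarrow> 'e) \<Rightarrow> bool) \<Rightarrow> ('a::topological_space, 'e::topological_space) chart set \<Rightarrow> bool"
  where
  "atlas H A \<longleftrightarrow>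
     (\<Union>c\<in>A. fst c) = UNIV \<and>
     (\<forall>c\<in>A. open (fst c) \<and> open (snd c ` fst c) \<and>
        homeomorphism (fst c) (snd c ` fst c) (snd c) (chart_inv c)) \<and>
     (\<forall>c\<in>A. \<forall>d\<in>A. H (snd c ` (fst c \<inter> fst d)) (snd d \<circ> chart_inv c))"

section \<open>Riemann surfaces and complex Lie groups\<close>

text \<open>Manifolds are Hausdorff spaces carried by a whole type. Second countability is not required:
  it is automatic for connected Riemann surfaces and for connected Lie groups.\<close>

locale riemann_surface =
  fixes A :: "('a::t2_space, complex) chart set"
  assumes holomorphic_atlas: "atlas (\<lambda>S f. f holomorphic_on S) A"

definition vec_holomorphic_on :: "(complex^'n \<Rightarrow> complex^'m) \<Rightarrow> (complex^'n) set \<Rightarrow> bool" where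
  "vec_holomorphic_on f S \<longleftrightarrow>
     (\<forall>x\<in>S. \<exists>f'. (f has_derivative f') (at x) \<and> (\<forall>a v. f' (a *s v) = a *s f' v))"

definition vec_holomorphic_on2 ::
  "((complex^'n) \<times> (complex^'n) \<Rightarrow> complex^'m) \<Rightarrow> ((complex^'n) \<times> (complex^'n)) set \<Rightarrow> bool" where
  "vec_holomorphic_on2 f S \<longleftrightarrow>
     (\<forall>x\<in>S. \<exists>f'. (f has_derivative f') (at x) \<and> (\<forall>a u v. f' (a *s u, a *s v) = a *s f' (u, v)))"

locale complex_lie_group = group G
  for G :: "'g::t2_space monoid" (structure) +
  fixes A :: "('g, complex^'n) chart set"
  assumes carrier_UNIV: "carrier G = UNIV"
    and holomorphic_atlas: "atlas (\<lambda>S f. vec_holomorphic_on f S) A"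
    and continuous_mult: "continuous_on UNIV (\<lambda>(g, h). g \<otimes> h)"
    and holomorphic_mult: "\<And>c d e. \<lbrakk>c \<in> A; d \<in> A; e \<in> A\<rbrakk> \<Longrightarrow>
      vec_holomorphic_on2 (\<lambda>(u, v). snd e (chart_inv c u \<otimes> chart_inv d v))
        {(snd c g, snd d h) |g h. g \<in> fst c \<and> h \<in> fst d \<and> g \<otimes> h \<in> fst e}"
    and continuous_inverse: "continuous_on UNIV (\<lambda>g. inv g)"
    and holomorphic_inverse: "\<And>c d. \<lbrakk>c \<in> A; d \<in> A\<rbrakk> \<Longrightarrow>
      vec_holomorphic_on (\<lambda>u. snd d (inv (chart_inv c u)))
        {snd c g |g. g \<in> fst c \<and> inv g \<in> fst d}"

section \<open>The Lie algebra\<close>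

text \<open>The Lie algebra is the tangent space at the identity, written in the coordinates of one chart
  around the identity, so that its underlying vector space is \<^typ>\<open>complex^'n\<close>. A different choice
  of chart changes everything below by a complex linear isomorphism.\<close>

definition id_chart :: "'g monoid \<Rightarrow> ('g, complex^'n) chart set \<Rightarrow> ('g, complex^'n) chart" where
  "id_chart G A = (SOME c. c \<in> A \<and> \<one>\<^bsub>G\<^esub> \<in> fst c)"

text \<open>The left-invariant vector field with value \<open>v\<close> at the identity, in these coordinates.\<close>

definition left_invariant_field ::
  "'g monoid \<Rightarrow> ('g, complex^'n) chart set \<Rightarrow> complex^'n \<Rightarrow> complex^'n \<Rightarrow> complex^'n" where
  "left_invariant_field G A v a =
     (let k = id_chart G A in
      frechet_derivative (\<lambda>b. snd k (chart_inv k a \<otimes>\<^bsub>G\<^esub> chart_inv k b)) (at (snd k \<one>\<^bsub>G\<^esub>)) v)"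

text \<open>The commutator \<open>[X, Y] = DY X - DX Y\<close> of left-invariant vector fields, evaluated at the
  identity.\<close>

definition lie_bracket ::
  "'g monoid \<Rightarrow> ('g, complex^'n) chart set \<Rightarrow> complex^'n \<Rightarrow> complex^'n \<Rightarrow> complex^'n" where
  "lie_bracket G A v w =
     (let e = snd (id_chart G A) \<one>\<^bsub>G\<^esub> in
      frechet_derivative (left_invariant_field G A w) (at e) v -
      frechet_derivative (left_invariant_field G A v) (at e) w)"

definition simple_lie_algebra :: "(complex^'n \<Rightarrow> complex^'n \<Rightarrow> complex^'n) \<Rightarrow> bool" where
  "simple_lie_algebra br \<longleftrightarrow>
     (\<exists>v w. br v w \<noteq> 0) \<and>
     (\<forall>I. vec.subspace I \<and> (\<forall>v. \<forall>w\<in>I. br v w \<in> I) \<longrightarrow> I = {0} \<or> I = UNIV)"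

section \<open>Holomorphic maps, one-forms and the equation\<close>

definition holomorphic_map ::
  "('a::topological_space, complex) chart set \<Rightarrow> ('g::topological_space, complex^'n) chart set \<Rightarrow>
   'a set \<Rightarrow> ('a \<Rightarrow> 'g) \<Rightarrow> bool" where
  "holomorphic_map A B U f \<longleftrightarrow>
     continuous_on U f \<and>
     (\<forall>c\<in>A. \<forall>d\<in>B. \<forall>k.
        (\<lambda>z. snd d (f (chart_inv c z)) $ k) holomorphic_on (snd c ` {x \<in> U \<inter> fst c. f x \<in> fst d}))"

text \<open>A one-form \<open>\<xi>\<close> on the open set \<open>M\<close> with values in the Lie algebra is given by its
  coefficients: in the chart \<open>c\<close> with coordinate \<open>z\<close> it is \<open>\<xi> c dz\<close>, where \<open>\<xi> c\<close> is regarded as a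
  function of the point. The values of \<open>\<xi> c\<close> outside \<open>M \<inter> fst c\<close> are irrelevant.\<close>

type_synonym ('a, 'v) one_form = "('a, complex) chart \<Rightarrow> 'a \<Rightarrow> 'v"

definition holomorphic_one_forms ::
  "('a, complex) chart set \<Rightarrow> 'a set \<Rightarrow> ('a, complex^'n) one_form set" where
  "holomorphic_one_forms A M = {\<xi>.
     (\<forall>c\<in>A. \<forall>k. (\<lambda>z. \<xi> c (chart_inv c z) $ k) holomorphic_on (snd c ` (M \<inter> fst c))) \<and>
     (\<forall>c\<in>A. \<forall>d\<in>A. \<forall>x \<in> M \<inter> fst c \<inter> fst d.
        \<xi> c x = deriv (snd d \<circ> chart_inv c) (snd c x) *s \<xi> d x)}"

text \<open>The operator \<open>lam \<partial> + \<xi>\<close> is represented by the pair \<open>(lam, \<xi>)\<close>.\<close>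

definition operator_hyperplane ::
  "('a, complex) chart set \<Rightarrow> 'a set \<Rightarrow> complex \<Rightarrow> (complex \<times> ('a, complex^'n) one_form) set" where
  "operator_hyperplane A M lam = {lam} \<times> holomorphic_one_forms A M"

text \<open>The one-form \<open>(\<partial>\<psi>)\<psi>\<inverse>\<close>: the derivative at \<open>x\<close> of \<open>\<psi>\<close>, moved to the identity by right
  translation with \<open>\<psi>(x)\<inverse>\<close>.\<close>

definition right_log_deriv ::
  "'g monoid \<Rightarrow> ('g, complex^'n) chart set \<Rightarrow> ('a \<Rightarrow> 'g) \<Rightarrow> ('a, complex^'n) one_form" where
  "right_log_deriv G B \<psi> c x =
     (\<chi> k. deriv (\<lambda>z. snd (id_chart G B) (\<psi> (chart_inv c z) \<otimes>\<^bsub>G\<^esub> inv\<^bsub>G\<^esub> \<psi> x) $ k) (snd c x))"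

definition is_solution ::
  "'g::topological_space monoid \<Rightarrow> ('g, complex^'n) chart set \<Rightarrow>
   ('a::topological_space, complex) chart set \<Rightarrow> complex \<Rightarrow> ('a, complex^'n) one_form \<Rightarrow>
   'a set \<Rightarrow> ('a \<Rightarrow> 'g) \<Rightarrow> bool" where
  "is_solution G B A lam \<xi> U \<psi> \<longleftrightarrow>
     holomorphic_map A B U \<psi> \<and>
     (\<forall>c\<in>A. \<forall>x \<in> U \<inter> fst c. lam *s right_log_deriv G B \<psi> c x + \<xi> c x = 0)"

section \<open>Good covers\<close>

definition good_open_cover :: "'a::topological_space set \<Rightarrow> 'i set \<Rightarrow> ('i \<Rightarrow> 'a set) \<Rightarrow> bool" where
  "good_open_cover M I U \<longleftrightarrow>
     (\<forall>i\<in>I. open (U i)) \<and> (\<Union>i\<in>I. U i) = M \<and>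
     (\<forall>J. J \<subseteq> I \<and> finite J \<and> J \<noteq> {} \<and> (\<Inter>j\<in>J. U j) \<noteq> {} \<longrightarrow> contractible (\<Inter>j\<in>J. U j))"

section \<open>Holomorphic principal bundles\<close>

text \<open>A principal bundle over the open subset \<open>M\<close> of a Riemann surface with atlas \<open>A\<close> consists of a
  total space \<open>P\<close>, a projection \<open>\<pi>\<close>, a right action \<open>act\<close> of the group, and a set \<open>T\<close> of local
  trivialisations \<open>(U, h)\<close>, where \<open>h\<close> is the group component of the equivariant homeomorphism from
  \<open>\<pi>\<inverse>(U)\<close> to \<open>U \<times> G\<close>. The holomorphic structure is the one for which these trivialisations are
  biholomorphic; it is well defined because the transition functions are holomorphic.\<close>

definition local_trivialisation ::
  "'g::topological_space monoid \<Rightarrow> 'a::topological_space set \<Rightarrow>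
   'p topology \<Rightarrow> ('p \<Rightarrow> 'a) \<Rightarrow> ('p \<Rightarrow> 'g \<Rightarrow> 'p) \<Rightarrow> 'a set \<times> ('p \<Rightarrow> 'g) \<Rightarrow> bool" where
  "local_trivialisation G M P \<pi> act = (\<lambda>(U, h).
     open U \<and> U \<subseteq> M \<and>
     homeomorphic_map (subtopology P {p \<in> topspace P. \<pi> p \<in> U})
       (prod_topology (top_of_set U) euclidean) (\<lambda>p. (\<pi> p, h p)) \<and>
     (\<forall>p\<in>topspace P. \<forall>g. \<pi> p \<in> U \<longrightarrow> h (act p g) = h p \<otimes>\<^bsub>G\<^esub> g))"

text \<open>\<open>f\<close> is the transition function from the trivialisation \<open>t\<close> to the trivialisation \<open>s\<close>.\<close>

definition transition_function ::
  "'g monoid \<Rightarrow> 'p topology \<Rightarrow> ('p \<Rightarrow> 'a) \<Rightarrow>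
   'a set \<times> ('p \<Rightarrow> 'g) \<Rightarrow> 'a set \<times> ('p \<Rightarrow> 'g) \<Rightarrow> ('a \<Rightarrow> 'g) \<Rightarrow> bool" where
  "transition_function G P \<pi> s t f \<longleftrightarrow>
     (\<forall>p\<in>topspace P. \<pi> p \<in> fst s \<inter> fst t \<longrightarrow> snd s p = f (\<pi> p) \<otimes>\<^bsub>G\<^esub> snd t p)"

definition holomorphic_principal_bundle ::
  "'g::topological_space monoid \<Rightarrow> ('g, complex^'n) chart set \<Rightarrow>
   ('a::topological_space, complex) chart set \<Rightarrow> 'a set \<Rightarrow>
   'p topology \<Rightarrow> ('p \<Rightarrow> 'a) \<Rightarrow> ('p \<Rightarrow> 'g \<Rightarrow> 'p) \<Rightarrow> ('a set \<times> ('p \<Rightarrow> 'g)) set \<Rightarrow> bool" where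
  "holomorphic_principal_bundle G B A M P \<pi> act T \<longleftrightarrow>
     continuous_map P (top_of_set M) \<pi> \<and>
     (\<forall>p\<in>topspace P. act p \<one>\<^bsub>G\<^esub> = p) \<and>
     (\<forall>p\<in>topspace P. \<forall>g. act p g \<in> topspace P \<and> \<pi> (act p g) = \<pi> p) \<and>
     (\<forall>p\<in>topspace P. \<forall>g h. act (act p g) h = act p (g \<otimes>\<^bsub>G\<^esub> h)) \<and>
     (\<Union>t\<in>T. fst t) = M \<and>
     (\<forall>t\<in>T. local_trivialisation G M P \<pi> act t) \<and>
     (\<forall>s\<in>T. \<forall>t\<in>T. \<exists>f. holomorphic_map A B (fst s \<inter> fst t) f \<and> transition_function G P \<pi> s t f)"

definition locally_constant_on :: "('a::topological_space \<Rightarrow> 'b) \<Rightarrow> 'a set \<Rightarrow> bool" where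
  "locally_constant_on f S \<longleftrightarrow> (\<forall>x\<in>S. \<exists>V. open V \<and> x \<in> V \<and> f constant_on (S \<inter> V))"

text \<open>A holomorphic principal bundle is flat if, within its holomorphic structure, it can be
  trivialised over an open cover with locally constant transition functions.\<close>

definition flat_bundle ::
  "'g::topological_space monoid \<Rightarrow> ('g, complex^'n) chart set \<Rightarrow>
   ('a::topological_space, complex) chart set \<Rightarrow> 'a set \<Rightarrow>
   'p topology \<Rightarrow> ('p \<Rightarrow> 'a) \<Rightarrow> ('p \<Rightarrow> 'g \<Rightarrow> 'p) \<Rightarrow> ('a set \<times> ('p \<Rightarrow> 'g)) set \<Rightarrow> bool" where
  "flat_bundle G B A M P \<pi> act T \<longleftrightarrow>
     (\<exists>T'. holomorphic_principal_bundle G B A M P \<pi> act (T \<union> T') \<and>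
        (\<Union>t\<in>T'. fst t) = M \<and>
        (\<forall>s\<in>T'. \<forall>t\<in>T'. \<exists>f. locally_constant_on f (fst s \<inter> fst t) \<and> transition_function G P \<pi> s t f))"

definition holomorphic_cocycle ::
  "'g::topological_space monoid \<Rightarrow> ('g, complex^'n) chart set \<Rightarrow>
   ('a::topological_space, complex) chart set \<Rightarrow>
   'i set \<Rightarrow> ('i \<Rightarrow> 'a set) \<Rightarrow> ('i \<Rightarrow> 'i \<Rightarrow> 'a \<Rightarrow> 'g) \<Rightarrow> bool" where
  "holomorphic_cocycle G B A I U \<phi> \<longleftrightarrow>
     (\<forall>i\<in>I. \<forall>j\<in>I. holomorphic_map A B (U i \<inter> U j) (\<phi> i j)) \<and>
     (\<forall>i\<in>I. \<forall>x\<in>U i. \<phi> i i x = \<one>\<^bsub>G\<^esub>) \<and>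
     (\<forall>i\<in>I. \<forall>j\<in>I. \<forall>k\<in>I. \<forall>x\<in>U i \<inter> U j \<inter> U k. \<phi> i j x \<otimes>\<^bsub>G\<^esub> \<phi> j k x = \<phi> i k x)"

end

theory Submission
  imports Defs "HOL-Complex_Analysis.Cauchy_Integral_Formula"
begin

text \<open>Locally the equation is a holomorphic ordinary differential equation in a chart of the group
  around the identity, which Picard iteration solves. Two solutions have the same right
  logarithmic derivative, so \<open>\<psi>\<^sub>i\<inverse>\<psi>\<^sub>j\<close> has zero derivative and is locally constant, hence constant on
  the connected set \<open>U\<^sub>i \<inter> U\<^sub>j\<close>; local solutions therefore form a locally constant sheaf, which has a
  section over every contractible set. The cocycle \<open>\<psi>\<^sub>i\<inverse>\<psi>\<^sub>j\<close> is a coboundary of holomorphic maps,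
  so that the bundle lives on \<open>M \<times> G\<close>.\<close>

section \<open>Complex derivatives of vector-valued functions\<close>

text \<open>Multiplying a solution on the right by a constant gives a solution again, so a local
  solution can be given any value at any point of its domain; conversely two solutions differ on the
  right by the locally constant factor \<open>\<psi>\<^sub>i\<inverse>\<psi>\<^sub>j\<close>. For
  \<open>lam = 0\<close> the equation reduces to \<open>\<xi> = 0\<close> and leaves
  \<open>\<psi>\<close> free, hence existence, constancy and flatness are claimed for nonzero
  \<open>lam\<close>, whereas the cocycle and the bundle come from holomorphy of the
  \<open>\<psi>\<^sub>i\<close>. Two obstacles shape the proof. The group law is only known to be
  complex differentiable at each point, while the right-hand side of the differential equation is
  itself a derivative of the group law; its Lipschitz bound and its holomorphy along curves have to
  be extracted from Cauchy estimates. And contractibility is purely topological: the contraction is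
  merely continuous, so the equation cannot be solved along its tracks, and solutions are
  transported by local existence and uniqueness alone.\<close>

definition has_cderiv :: "(complex \<Rightarrow> complex^'n) \<Rightarrow> complex^'n \<Rightarrow> complex \<Rightarrow> bool" where
  "has_cderiv f v z \<longleftrightarrow> (f has_derivative (\<lambda>t. t *s v)) (at z)"

text \<open>Bridge between two calculi: total derivatives compose with the group law, components are
  accessible to one-variable complex analysis. For the converse the vector is reassembled from its
  components along the unit vectors \<open>axis k\<close>.\<close>

lemma has_cderiv_iff:
  "has_cderiv f v z \<longleftrightarrow> (\<forall>k. ((\<lambda>w. f w $ k) has_field_derivative v $ k) (at z))"
proof
  assume "has_cderiv f v z"
  then have "((\<lambda>w. f w $ k) has_derivative (\<lambda>t. (t *s v) $ k)) (at z)" for k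
    unfolding has_cderiv_def
    by (rule bounded_linear.has_derivative[OF bounded_linear_vec_nth])
  then show "\<forall>k. ((\<lambda>w. f w $ k) has_field_derivative v $ k) (at z)"
    by (auto simp: has_field_derivative_def mult.commute[of _ "v $ _"] 
        intro: has_derivative_eq_rhs)
next
  assume *: "\<forall>k. ((\<lambda>w. f w $ k) has_field_derivative v $ k) (at z)"
  have ax: "bounded_linear (axis k :: complex \<Rightarrow> complex^'n)" for k
    by (intro linear_conv_bounded_linear[THEN iffD1] linearI) (auto simp: axis_def vec_eq_iff)
  have eq: "(\<Sum>k\<in>UNIV. axis k (w $ k)) = w" for w :: "complex^'n"
    by (simp add: vec_eq_iff axis_def)
  have "((\<lambda>w. \<Sum>k\<in>UNIV. axis k (f w $ k)) has_derivative 
      (\<lambda>t. \<Sum>k\<in>UNIV. axis k ((t *s v) $ k))) (at z)"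
    using * unfolding has_field_derivative_def
    by (intro has_derivative_sum bounded_linear.has_derivative[OF ax])
       (auto simp: mult_commute_abs)
  then show "has_cderiv f v z"
    unfolding has_cderiv_def eq .
qed

lemma has_cderiv_nth:
  "has_cderiv f v z \<Longrightarrow> ((\<lambda>w. f w $ k) has_field_derivative v $ k) (at z)"
  by (simp add: has_cderiv_iff)

lemma has_cderiv_unique:
  assumes "has_cderiv f v z" "has_cderiv f w z"
  shows "v = w"
  using assms by (auto simp: has_cderiv_iff vec_eq_iff intro: DERIV_unique)

lemma has_cderiv_isCont: "has_cderiv f v z \<Longrightarrow> isCont f z"
  unfolding has_cderiv_def by (rule has_derivative_continuous)

lemma has_cderiv_const: "has_cderiv (\<lambda>_. c) 0 z"
  by (simp add: has_cderiv_iff)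

lemma has_cderiv_diff:
  "has_cderiv f v z \<Longrightarrow> has_cderiv g w z \<Longrightarrow> has_cderiv (\<lambda>z. f z - g z) (v - w) z"
  by (simp add: has_cderiv_iff DERIV_diff)

lemma has_cderiv_cong:
  assumes "\<forall>\<^sub>F w in nhds z. f w = g w"
  shows "has_cderiv f v z \<longleftrightarrow> has_cderiv g v z"
  unfolding has_cderiv_iff
  by (intro all_cong1 DERIV_cong_ev) (use assms in \<open>auto elim: eventually_mono\<close>)

lemma has_cderiv_transform:
  "has_cderiv f v z \<Longrightarrow> \<forall>\<^sub>F w in nhds z. f w = g w \<Longrightarrow> has_cderiv g v z"
  by (simp add: has_cderiv_cong)

lemma has_cderiv_chain:
  assumes "has_cderiv f v (\<tau> z)" and "(\<tau> has_field_derivative a) (at z)"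
  shows "has_cderiv (\<lambda>w. f (\<tau> w)) (a *s v) z"
  using assms by (auto simp: has_cderiv_iff mult.commute[of a] intro: DERIV_chain2)

text \<open>Complex homogeneity of \<open>L\<close> pulls the scalar out of
  \<open>L (t *s v)\<close> and so restores the shape that \<open>has_cderiv\<close> demands.
  \<open>\<Phi>\<close> stands for a coordinate expression of inversion, and in the two-variable
  form below for one of multiplication.\<close>

lemma has_cderiv_compose:
  assumes "(\<Phi> has_derivative L) (at (f z))" and "\<And>a v. L (a *s v) = a *s L v" 
    and "has_cderiv f v z"
  shows "has_cderiv (\<lambda>w. \<Phi> (f w)) (L v) z"
  using has_derivative_compose[OF assms(3)[unfolded has_cderiv_def] assms(1)] assms(2)
  by (simp add: has_cderiv_def)

lemma has_cderiv_compose2: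
  assumes "(\<Phi> has_derivative L) (at (f z, g z))" and "\<And>a u v. L (a *s u, a *s v) = a *s L (u, v)" 
    and "has_cderiv f u z" "has_cderiv g v z"
  shows "has_cderiv (\<lambda>w. \<Phi> (f w, g w)) (L (u, v)) z"
  using has_derivative_compose[OF has_derivative_Pair[OF assms(3)[unfolded has_cderiv_def] 
        assms(4)[unfolded has_cderiv_def]] assms(1)] assms(2)
  by (simp add: has_cderiv_def)

lemma norm_smult_vec: "norm (a *s (v :: complex^'n)) = norm a * norm v"
  by (simp add: norm_vec_def norm_mult L2_set_right_distrib)

text \<open>The Euclidean norm is at most the sum of the moduli of the components. This crude step
  is the origin of the \<open>CARD\<close> factors in the later estimates.\<close>

lemma norm_vec_le_bound:
  fixes v :: "complex^'n" and B :: real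
  assumes "\<And>k. norm (v $ k) \<le> B"
  shows "norm v \<le> CARD('n) * B"
proof -
  have "norm v \<le> (\<Sum>k\<in>UNIV. norm (v $ k))"
    unfolding norm_vec_def by (rule L2_set_le_sum) auto
  also have "\<dots> \<le> (\<Sum>k\<in>(UNIV::'n set). B)" by (intro sum_mono assms)
  finally show ?thesis by simp
qed

text \<open>Mean value inequality on a convex set, the operator norm of
  \<open>t \<mapsto> t *s v\<close> being at most \<open>norm v\<close>. It serves the contraction
  estimate of the Picard iteration and, with \<open>B = 0\<close>, the local constancy of quotients
  of solutions.\<close>

lemma has_cderiv_lipschitz:
  assumes "\<And>z. z \<in> ball a r \<Longrightarrow> has_cderiv f (f' z) z" "\<And>z. z \<in> ball a r \<Longrightarrow> norm (f' z) \<le> B"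
    and "x \<in> ball a r" "y \<in> ball a r"
  shows "norm (f x - f y) \<le> B * norm (x - y)"
proof (rule differentiable_bound[where S = "ball a r" and f' = "\<lambda>z t. t *s f' z"])
  fix z assume z: "z \<in> ball a r"
  show "(f has_derivative (\<lambda>t. t *s f' z)) (at z within ball a r)"
    using assms(1)[OF z] by (auto simp: has_cderiv_def intro: has_derivative_at_withinI)
  show "onorm (\<lambda>t. t *s f' z) \<le> B"
    by (rule onorm_le) (use assms(2)[OF z] in \<open>auto simp: norm_smult_vec mult.commute[of B] intro: mult_left_mono\<close>)
qed (use assms in auto)

section \<open>Holomorphic initial value problems\<close>

lemma vector_primitive:
  fixes f :: "complex \<Rightarrow> complex^'n"
  assumes "\<And>k. (\<lambda>z. f z $ k) holomorphic_on ball z0 r" "r > 0"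
  obtains g where "g z0 = e" "\<And>z. z \<in> ball z0 r \<Longrightarrow> has_cderiv g (f z) z"
proof -
  have "\<exists>g. g z0 = e $ k \<and> (\<forall>z\<in>ball z0 r. (g has_field_derivative f z $ k) (at z))" for k
  proof -
    obtain g where g: "\<And>z. z \<in> ball z0 r \<Longrightarrow> (g has_field_derivative f z $ k) (at z within ball z0 r)"
      using holomorphic_convex_primitive'[OF convex_ball open_ball assms(1)] by blast
    then have "((\<lambda>z. g z - g z0 + e $ k) has_field_derivative f z $ k) (at z)" if "z \<in> ball z0 r" for z
      using g[OF that] that by (auto simp: at_within_open[of _ "ball z0 r"] intro!: derivative_eq_intros)
    then show ?thesis by (intro exI[of _ "\<lambda>z. g z - g z0 + e $ k"]) auto
  qed
  then obtain g where "\<And>k. g k z0 = e $ k" 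
    "\<And>k z. z \<in> ball z0 r \<Longrightarrow> (g k has_field_derivative f z $ k) (at z)" by metis
  then show thesis
    by (intro that[of "\<lambda>z. \<chi> k. g k z"]) (auto simp: has_cderiv_iff vec_eq_iff)
qed

lemma has_cderiv_imp_holomorphic:
  fixes f :: "complex \<Rightarrow> complex^'n"
  assumes "\<And>z. z \<in> S \<Longrightarrow> \<exists>v. has_cderiv f v z"
  shows "(\<lambda>z. f z $ k) holomorphic_on S"
  unfolding holomorphic_on_def field_differentiable_def
  using assms by (metis has_cderiv_nth has_field_derivative_at_within)

text \<open>Hypothesis \<open>hol\<close> asks for holomorphy of \<open>G\<close> only along
  holomorphic curves. That is all a Picard step needs, since the next iterate is a primitive of
  \<open>z \<mapsto> G z (u z)\<close> on a disc, and it is what can be verified when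
  \<open>G\<close> is a derivative of the group law.\<close>

lemma holomorphic_initial_value_problem:
  fixes G :: "complex \<Rightarrow> complex^'n \<Rightarrow> complex^'n"
  assumes "R > 0" "\<rho> > 0"
    and bound: "\<And>z v. z \<in> ball z0 R \<Longrightarrow> v \<in> ball e \<rho> \<Longrightarrow> norm (G z v) \<le> K"
    and lip: "\<And>z v w. z \<in> ball z0 R \<Longrightarrow> v \<in> ball e \<rho> \<Longrightarrow> w \<in> ball e \<rho> \<Longrightarrow> 
                norm (G z v - G z w) \<le> L * norm (v - w)"
    and hol: "\<And>u r k. r \<le> R \<Longrightarrow> (\<And>z. z \<in> ball z0 r \<Longrightarrow> u z \<in> ball e \<rho> \<and> (\<exists>v. has_cderiv u v z)) \<Longrightarrow> 
                (\<lambda>z. G z (u z) $ k) holomorphic_on ball z0 r"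
  obtains u r where "0 < r" "r \<le> R" "u z0 = e" 
    "\<And>z. z \<in> ball z0 r \<Longrightarrow> u z \<in> ball e \<rho> \<and> has_cderiv u (G z (u z)) z"
proof -
  have "K \<ge> 0" using bound[of z0 e] assms(1,2) norm_ge_zero order_trans by (metis centre_in_ball)
  define L' where "L' = max L 0"
  have lip': "norm (G z v - G z w) \<le> L' * norm (v - w)"
    if "z \<in> ball z0 R" "v \<in> ball e \<rho>" "w \<in> ball e \<rho>" for z v w
    using lip[OF that] by (smt (verit) L'_def mult_right_mono norm_ge_zero)
  \<comment> \<open>The second bound gives \<open>K * r \<le> \<rho> / 2\<close>, which keeps the
    iterates in the half ball; the third gives \<open>L' * r \<le> 1 / 2\<close>, the contraction
    factor. The added 1 keeps both denominators positive.\<close>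
  define r where "r = min R (min (\<rho> / (2 * (K + 1))) (1 / (2 * (L' + 1))))"
  have L': "L' \<ge> 0" by (simp add: L'_def)
  have r: "0 < r" "r \<le> R" using assms(1,2) \<open>K \<ge> 0\<close> L' by (auto simp: r_def)
  have rK: "K * r \<le> \<rho> / 2"
  proof -
    have "K * r \<le> (K + 1) * (\<rho> / (2 * (K + 1)))" 
      using \<open>K \<ge> 0\<close> r by (intro mult_mono) (auto simp: r_def)
    also have "\<dots> = \<rho> / 2" using \<open>K \<ge> 0\<close> by (simp add: field_simps)
    finally show ?thesis .
  qed
  have rL: "L' * r \<le> 1 / 2"
  proof -
    have "L' * r \<le> (L' + 1) * (1 / (2 * (L' + 1)))" 
      using L' r by (intro mult_mono) (auto simp: r_def)
    also have "\<dots> = 1 / 2" using L' by (simp add: field_simps)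
    finally show ?thesis .
  qed
  define D where "D = ball z0 r"
  have DR: "z \<in> ball z0 R" if "z \<in> D" for z using that r by (auto simp: D_def)
  \<comment> \<open>The closed bound \<open>\<rho> / 2\<close> survives the passage to the limit and
    still places the values in the open ball of radius \<open>\<rho>\<close>, where
    \<open>bound\<close> and \<open>lip\<close> apply.\<close>
  define P where "P u \<longleftrightarrow> u z0 = e \<and> (\<forall>z\<in>D. norm (u z - e) \<le> \<rho> / 2 \<and> (\<exists>v. has_cderiv u v z))" for u
  have Pball: "u z \<in> ball e \<rho>" if "P u" "z \<in> D" for u z
    using that \<open>\<rho> > 0\<close> by (fastforce simp: P_def dist_norm norm_minus_commute)
  have step: "\<exists>w. P w \<and> (\<forall>z\<in>D. has_cderiv w (G z (u z)) z)" if u: "P u" for u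
  proof -
    have "(\<lambda>z. G z (u z) $ k) holomorphic_on ball z0 r" for k
      using u r Pball[OF u] by (intro hol) (auto simp: P_def D_def)
    then obtain w where w: "w z0 = e" "\<And>z. z \<in> ball z0 r \<Longrightarrow> has_cderiv w (G z (u z)) z"
      using vector_primitive \<open>r > 0\<close> by metis
    have "norm (w z - e) \<le> \<rho> / 2" if z: "z \<in> D" for z
    proof -
      have "norm (w z - w z0) \<le> K * norm (z - z0)"
        using w(2) z r bound Pball[OF u] DR
        by (intro has_cderiv_lipschitz[where f' = "\<lambda>z. G z (u z)" and a = z0 and r = r])
           (auto simp: D_def)
      also have "\<dots> \<le> K * r" using z \<open>K \<ge> 0\<close> 
        by (intro mult_left_mono) (auto simp: D_def dist_norm norm_minus_commute)
      finally show ?thesis using rK w(1) by simp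
    qed
    moreover have "\<exists>v. has_cderiv w v z" if "z \<in> D" for z
      using w(2)[of z] that unfolding D_def by blast
    ultimately have "P w" using w(1) by (simp add: P_def)
    then show ?thesis using w(2) by (intro exI[of _ w]) (simp add: D_def)
  qed
  have "P (\<lambda>_. e)" using has_cderiv_const \<open>\<rho> > 0\<close> by (auto simp: P_def)
  then obtain u where Pu: "\<And>n. P (u n)" 
    and du: "\<And>n z. z \<in> D \<Longrightarrow> has_cderiv (u (Suc n)) (G z (u n z)) z"
    using dependent_nat_choice[of "\<lambda>_. P" "\<lambda>_ u w. \<forall>z\<in>D. has_cderiv w (G z (u z)) z"] step by metis
  have diff: "norm (u (Suc n) z - u n z) \<le> \<rho> * (1/2) ^ n" if "z \<in> D" for n z
    using that
  proof (induction n arbitrary: z)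
    case 0
    have "norm (u (Suc 0) z - u 0 z) \<le> norm (u (Suc 0) z - e) + norm (u 0 z - e)"
      using norm_triangle_ineq4[of "u (Suc 0) z - e" "u 0 z - e"] by simp
    also have "\<dots> \<le> \<rho> / 2 + \<rho> / 2" using Pu 0 by (intro add_mono) (auto simp: P_def)
    finally show ?case by simp
  next
    case (Suc n)
    let ?h = "\<lambda>z. u (Suc (Suc n)) z - u (Suc n) z"
    let ?h' = "\<lambda>z. G z (u (Suc n) z) - G z (u n z)"
    \<comment> \<open>All iterates equal \<open>e\<close> at \<open>z0\<close>, so
      \<open>?h z0 = 0\<close> and the bound on the increment is a bound on \<open>?h z\<close>
      itself.\<close>
    have "norm (?h z - ?h z0) \<le> (L' * (\<rho> * (1/2) ^ n)) * norm (z - z0)"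
    proof (rule has_cderiv_lipschitz[where f' = ?h' and a = z0 and r = r])
      fix x assume x: "x \<in> ball z0 r"
      show "has_cderiv ?h (?h' x) x"
        using du[of x n] du[of x "Suc n"] x unfolding D_def by (blast intro: has_cderiv_diff)
      have "norm (?h' x) \<le> L' * norm (u (Suc n) x - u n x)"
        using x DR Pball[OF Pu] by (intro lip') (auto simp: D_def)
      also have "\<dots> \<le> L' * (\<rho> * (1/2) ^ n)"
        using Suc.IH[of x] x L' by (intro mult_left_mono) (auto simp: D_def)
      finally show "norm (?h' x) \<le> L' * (\<rho> * (1/2) ^ n)" .
    qed (use Suc.prems r in \<open>auto simp: D_def\<close>)
    also have "\<dots> \<le> (L' * (\<rho> * (1/2) ^ n)) * r"
      using Suc.prems L' \<open>\<rho> > 0\<close>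
      by (intro mult_left_mono) (auto simp: D_def dist_norm norm_minus_commute)
    also have "\<dots> = (L' * r) * (\<rho> * (1/2) ^ n)" by simp
    also have "\<dots> \<le> (1/2) * (\<rho> * (1/2) ^ n)" using rL \<open>\<rho> > 0\<close> by (intro mult_right_mono) auto
    finally show ?case using Pu[of "Suc (Suc n)"] Pu[of "Suc n"] by (simp add: P_def)
  qed
  \<comment> \<open>The iterates are \<open>u 0\<close> plus partial sums of their increments, so
    the geometric decay in \<open>diff\<close> yields uniform convergence.\<close>
  have "uniformly_convergent_on D (\<lambda>n z. \<Sum>i<n. u (Suc i) z - u i z)"
    by (rule Weierstrass_m_test'[where M = "\<lambda>n. \<rho> * (1/2) ^ n"])
       (use diff in \<open>auto intro!: summable_mult summable_geometric\<close>)
  then obtain l where l: "uniform_limit D (\<lambda>n z. \<Sum>i<n. u (Suc i) z - u i z) l sequentially"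
    by (auto simp: uniformly_convergent_on_def)
  define U where "U z = u 0 z + l z" for z
  have "uniform_limit D (\<lambda>n z. u 0 z + (\<Sum>i<n. u (Suc i) z - u i z)) U sequentially"
    unfolding U_def by (intro uniform_limit_add l uniform_limit_const)
  moreover have "u 0 z + (\<Sum>i<n. u (Suc i) z - u i z) = u n z" for n z
    using sum_lessThan_telescope[of "\<lambda>i. u i z" n] by simp
  ultimately have ulim: "uniform_limit D u U sequentially" by simp
  have lim: "(\<lambda>n. u n z) \<longlonglongrightarrow> U z" if "z \<in> D" for z
    using tendsto_uniform_limitI[OF ulim that] .
  have "z0 \<in> D" using r by (simp add: D_def)
  have Uball: "norm (U z - e) \<le> \<rho> / 2" if "z \<in> D" for z
    by (rule tendsto_upperbound[OF tendsto_norm[OF tendsto_diff[OF lim[OF that] tendsto_const]]])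
       (use Pu that in \<open>auto simp: P_def\<close>)
  then have Uball': "U z \<in> ball e \<rho>" if "z \<in> D" for z
    using that \<open>\<rho> > 0\<close> by (fastforce simp: dist_norm norm_minus_commute)
  have "has_cderiv U (G z (U z)) z" if z: "z \<in> D" for z
    unfolding has_cderiv_iff
  proof
    fix k
    \<comment> \<open>Weierstrass: for locally uniform limits of holomorphic functions the
      derivatives converge to the derivative of the limit. Their limit is identified as
      \<open>G z (U z) $ k\<close> afterwards, by the Lipschitz bound.\<close>
    have "\<exists>g'. \<forall>x\<in>D. ((\<lambda>z. U z $ k) has_field_derivative g' x) (at x) \<and> 
            (\<lambda>n. G x (u n x) $ k) \<longlonglongrightarrow> g' x"
    proof (rule has_complex_derivative_uniform_sequence[where f = "\<lambda>n z. u (Suc n) z $ k"])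
      show "open D" by (simp add: D_def)
      show "((\<lambda>z. u (Suc n) z $ k) has_field_derivative G x (u n x) $ k) (at x)" if "x \<in> D" for n x
        using has_cderiv_nth[OF du[OF that]] .
      fix x assume "x \<in> D"
      then obtain d where d: "d > 0" "cball x d \<subseteq> D"
        using open_contains_cball_eq[of D] by (auto simp: D_def)
      have "uniform_limit D (\<lambda>n. u (Suc n)) U sequentially"
        using ulim by (rule filterlim_compose) (rule filterlim_Suc)
      then have "uniform_limit D (\<lambda>n z. u (Suc n) z $ k) (\<lambda>z. U z $ k) sequentially"
        by (rule bounded_linear.uniform_limit[OF bounded_linear_vec_nth])
      then show "\<exists>d>0. cball x d \<subseteq> D \<and> 
          uniform_limit (cball x d) (\<lambda>n z. u (Suc n) z $ k) (\<lambda>z. U z $ k) sequentially"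
        using d by (intro exI[of _ d] conjI) (auto intro: uniform_limit_on_subset)
    qed
    then obtain g' where g': "((\<lambda>z. U z $ k) has_field_derivative g' z) (at z)"
       "(\<lambda>n. G z (u n z) $ k) \<longlonglongrightarrow> g' z" using z by blast
    have "(\<lambda>n. G z (u n z) - G z (U z)) \<longlonglongrightarrow> 0"
    proof (rule Lim_null_comparison)
      show "\<forall>\<^sub>F n in sequentially. norm (G z (u n z) - G z (U z)) \<le> L' * norm (u n z - U z)"
        using z DR Pball[OF Pu] Uball' by (intro always_eventually allI lip') auto
      show "(\<lambda>n. L' * norm (u n z - U z)) \<longlonglongrightarrow> 0"
        using tendsto_mult_left[OF tendsto_norm_zero[OF LIM_zero[OF lim[OF z]]], of L'] by simp
    qed
    then have "(\<lambda>n. G z (u n z) $ k) \<longlonglongrightarrow> G z (U z) $ k"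
      by (rule tendsto_vec_nth[OF LIM_zero_cancel])
    then have "g' z = G z (U z) $ k" by (rule LIMSEQ_unique[OF g'(2)])
    then show "((\<lambda>z. U z $ k) has_field_derivative G z (U z) $ k) (at z)" using g'(1) by simp
  qed
  moreover have "U z0 = e"
  proof -
    have "(\<lambda>n. u n z0) \<longlonglongrightarrow> e" using Pu by (simp add: P_def)
    then show ?thesis by (rule LIMSEQ_unique[OF lim[OF \<open>z0 \<in> D\<close>]])
  qed
  ultimately show thesis using that[of r U] r Uball' unfolding D_def by blast
qed

text \<open>Cauchy's inequality on the circle of radius \<open>s / 2\<close> about 0 gives
  \<open>2 * B / s\<close> for the first derivative of a component. About a point of the half disc
  the circle of radius \<open>s / 4\<close> gives \<open>2 * B / (s / 4)\<^sup>2\<close> for the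
  second derivative, whence the constant 32; Taylor's formula of order one turns this into the
  remainder bound.\<close>

lemma cauchy_estimate_vec:
  fixes h :: "complex \<Rightarrow> complex^'n"
  assumes "s > 0" and h: "\<And>t. t \<in> ball 0 s \<Longrightarrow> \<exists>v. has_cderiv h v t"
    and B: "\<And>t. t \<in> ball 0 s \<Longrightarrow> norm (h t) \<le> B" and v: "has_cderiv h v 0"
  shows "norm v \<le> CARD('n) * (2 * B / s)"
    and "t \<in> ball 0 (s / 2) \<Longrightarrow> norm (h t - h 0 - t *s v) \<le> CARD('n) * (32 * B / s\<^sup>2 * (norm t)\<^sup>2)"
proof -
  define f where "f k t = h t $ k" for k t
  have hol: "f k holomorphic_on ball 0 s" for k
    unfolding f_def using h by (rule has_cderiv_imp_holomorphic)
  have fB: "norm (f k t) \<le> B" if "t \<in> ball 0 s" for k t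
    using B[OF that] component_le_norm_cart order_trans f_def by (metis Finite_Cartesian_Product.norm_nth_le)
  have deriv: "norm ((deriv ^^ n) (f k) x) \<le> fact n * B / d ^ n" 
    if "d > 0" "cball x d \<subseteq> ball 0 s" for k n x d
  proof (rule Cauchy_inequality)
    show "f k holomorphic_on ball x d" 
      using hol that(2) ball_subset_cball holomorphic_on_subset by blast
    show "continuous_on (cball x d) (f k)"
      using hol that(2) holomorphic_on_imp_continuous_on continuous_on_subset by blast
    show "norm (f k y) \<le> B" if "norm (x - y) = d" for y
      using \<open>cball x d \<subseteq> _\<close> that by (intro fB) (auto simp: dist_norm)
  qed fact
  have f1: "deriv (f k) 0 = v $ k" for k
    unfolding f_def by (rule DERIV_imp_deriv[OF has_cderiv_nth[OF v]])
  show "norm v \<le> CARD('n) * (2 * B / s)"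
  proof (rule norm_vec_le_bound)
    show "norm (v $ k) \<le> 2 * B / s" for k
      using deriv[of "s/2" 0 1 k] \<open>s > 0\<close> by (simp add: f1 cball_subset_ball_iff mult.commute)
  qed
  assume t: "t \<in> ball 0 (s / 2)"
  show "norm (h t - h 0 - t *s v) \<le> CARD('n) * (32 * B / s\<^sup>2 * (norm t)\<^sup>2)"
  proof (rule norm_vec_le_bound)
    fix k
    have "cmod ((deriv ^^ 0) (f k) t - (\<Sum>i\<le>1. (deriv ^^ i) (f k) 0 * (t - 0) ^ i / fact i)) 
      \<le> 32 * B / s\<^sup>2 * cmod (t - 0) ^ Suc 1 / fact 1"
    proof (rule complex_Taylor[OF convex_ball])
      show "((deriv ^^ i) (f k) has_field_derivative (deriv ^^ Suc i) (f k) x) 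
          (at x within ball 0 (s / 2))" if "x \<in> ball 0 (s/2)" for i x
      proof -
        have "(deriv ^^ i) (f k) holomorphic_on ball 0 s"
          using hol by (intro holomorphic_higher_deriv) auto
        then have "((deriv ^^ i) (f k) has_field_derivative deriv ((deriv ^^ i) (f k)) x) (at x)"
          using that \<open>s > 0\<close> by (intro holomorphic_derivI[of _ "ball 0 s"]) auto
        then show ?thesis by (auto intro: has_field_derivative_at_within)
      qed
      show "cmod ((deriv ^^ Suc 1) (f k) x) \<le> 32 * B / s\<^sup>2" if "x \<in> ball 0 (s/2)" for x
        using deriv[of "s/4" x 2 k] that \<open>s > 0\<close> 
        by (simp add: cball_subset_ball_iff power2_eq_square numeral_2_eq_2 field_simps)
      show "0 \<in> ball 0 (s / 2)" using \<open>s > 0\<close> by simp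
    qed (use t in auto)
    then show "norm ((h t - h 0 - t *s v) $ k) \<le> 32 * B / s\<^sup>2 * (norm t)\<^sup>2"
      by (simp add: f1) (simp add: f_def power2_eq_square algebra_simps)
  qed
qed

text \<open>The derivative in a direction \<open>q\<close> is the derivative at 0 of the restriction
  to the complex line \<open>t \<mapsto> x + t *s q\<close>, and Cauchy's estimate bounds it by the
  bound \<open>B\<close> on the function. No continuity of \<open>f'\<close> enters.\<close>

lemma bounded_holomorphic_lipschitz:
  fixes f :: "complex^'n \<Rightarrow> complex^'m"
  assumes "r > 0"
    and f': "\<And>x. x \<in> ball e r \<Longrightarrow> (f has_derivative f' x) (at x) \<and> (\<forall>a v. f' x (a *s v) = a *s f' x v)"
    and B: "\<And>x. x \<in> ball e r \<Longrightarrow> norm (f x) \<le> B"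
    and "x \<in> ball e (r / 2)" "y \<in> ball e (r / 2)"
  shows "norm (f x - f y) \<le> CARD('m) * (4 * B / r) * norm (x - y)"
proof (rule differentiable_bound[where S = "ball e (r / 2)" and f' = f'])
  fix x assume x: "x \<in> ball e (r / 2)"
  then have xr: "x \<in> ball e r" using \<open>r > 0\<close> by simp
  show "(f has_derivative f' x) (at x within ball e (r/2))"
    using f'[OF xr] has_derivative_at_withinI by blast
  show "onorm (f' x) \<le> CARD('m) * (4 * B / r)"
  proof (rule onorm_le)
    fix q :: "complex^'n"
    show "norm (f' x q) \<le> CARD('m) * (4 * B / r) * norm q"
    proof (cases "q = 0")
      case True
      then show ?thesis using f'[OF xr, THEN conjunct2, rule_format, of 0 0] by simp
    next
      case False
      \<comment> \<open>For \<open>t\<close> below this radius \<open>t *s q\<close> has norm less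
        than \<open>r / 2\<close>, so the line through a point of the half ball stays in the ball
        where \<open>B\<close> applies.\<close>
      define s where "s = r / (2 * norm q)"
      have in_ball: "x + t *s q \<in> ball e r" if "t \<in> ball 0 s" for t
      proof -
        have "norm (t *s q) < r / 2" 
          using that False by (simp add: norm_smult_vec s_def field_simps)
        moreover have "norm (x - e) < r / 2" using x by (simp add: dist_norm norm_minus_commute)
        ultimately have "norm ((x - e) + t *s q) < r" by (smt (verit) field_sum_of_halves norm_triangle_ineq)
        then show ?thesis by (simp add: dist_norm norm_minus_commute algebra_simps)
      qed
      have cd: "has_cderiv (\<lambda>t. f (x + t *s q)) (f' (x + t *s q) q) t" if "t \<in> ball 0 s" for t
        using f'[OF in_ball[OF that]]
        by (intro has_cderiv_compose[of f _ "\<lambda>t. x + t *s q"]) 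
           (auto simp: has_cderiv_iff intro!: derivative_eq_intros)
      have "norm (f' x q) \<le> CARD('m) * (2 * B / s)"
      proof (rule cauchy_estimate_vec(1))
        show "s > 0" using False \<open>r > 0\<close> by (simp add: s_def)
        then show "has_cderiv (\<lambda>t. f (x + t *s q)) (f' x q) 0" using cd[of 0] by simp
      qed (use cd in_ball B in auto)
      then show ?thesis using False by (simp add: s_def)
    qed
  qed
qed (use assms in auto)

text \<open>The group law is only assumed complex differentiable. Cauchy's estimate along complex lines
  replaces the second derivatives that the Lipschitz bound on \<open>D\<^sub>1m\<close> would ordinarily come from.\<close>

lemma group_law_initial_value_problem:
  fixes m :: "(complex^'n) \<times> (complex^'n) \<Rightarrow> complex^'n" and \<eta> :: "complex \<Rightarrow> complex^'n"
  assumes "r > 0" "R > 0"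
    and m': "\<And>u v. u \<in> ball e r \<Longrightarrow> v \<in> ball e r \<Longrightarrow> (m has_derivative m' (u, v)) (at (u, v)) \<and> 
          (\<forall>a p q. m' (u, v) (a *s p, a *s q) = a *s m' (u, v) (p, q))"
    and mB: "\<And>u v. u \<in> ball e r \<Longrightarrow> v \<in> ball e r \<Longrightarrow> norm (m (u, v)) \<le> B"
    and \<eta>: "\<And>k. (\<lambda>z. \<eta> z $ k) holomorphic_on ball z0 R"
  obtains u \<delta> where "0 < \<delta>" "\<delta> \<le> R" "u z0 = e"
     "\<And>z. z \<in> ball z0 \<delta> \<Longrightarrow> u z \<in> ball e r \<and> has_cderiv u (m' (e, u z) (\<eta> z, 0)) z"
proof -
  have "continuous_on (ball z0 R) (\<lambda>z. \<chi> k. \<eta> z $ k)"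
    using \<eta> by (intro continuous_on_vec_lambda holomorphic_on_imp_continuous_on)
  then have "continuous_on (cball z0 (R/2)) \<eta>"
    using \<open>R > 0\<close> by (auto intro: continuous_on_subset)
  then have "bounded (\<eta> ` cball z0 (R/2))"
    by (intro compact_imp_bounded compact_continuous_image compact_cball)
  then obtain N where N: "N > 0" "\<And>z. z \<in> cball z0 (R/2) \<Longrightarrow> norm (\<eta> z) \<le> N"
    unfolding bounded_pos by auto
  \<comment> \<open>A common radius for all \<open>z\<close>: since \<open>N\<close> bounds
    \<open>\<eta>\<close> on the half disc, \<open>e + t *s \<eta> z\<close> stays in the ball of
    radius \<open>r\<close> as long as \<open>norm t < s\<close>.\<close>
  define s where "s = r / N"
  have "s > 0" using \<open>r > 0\<close> N by (simp add: s_def)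
  have in_ball: "e + t *s \<eta> z \<in> ball e r" if "t \<in> ball 0 s" "z \<in> ball z0 (R/2)" for t z
  proof -
    have "norm (t *s \<eta> z) \<le> norm t * N" 
      using that N by (auto simp: norm_smult_vec intro: mult_left_mono)
    also have "\<dots> < r" using that N by (simp add: s_def field_simps)
    finally show ?thesis by (simp add: dist_norm)
  qed
  have B0: "B \<ge> 0" using mB[of e e] \<open>r > 0\<close> norm_ge_zero order_trans by (metis centre_in_ball)
  have half: "x \<in> ball e r" if "x \<in> ball e (r/2)" for x using that \<open>r > 0\<close> by simp
  define G where "G z v = m' (e, v) (\<eta> z, 0)" for z v
  define C where "C = CARD('n) * (4 * B / r)"
  have "C \<ge> 0" using B0 \<open>r > 0\<close> by (simp add: C_def)
  have mC: "norm (m (p, v) - m (p, w)) \<le> C * norm (v - w)" 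
    if "p \<in> ball e r" "v \<in> ball e (r/2)" "w \<in> ball e (r/2)" for p v w
    unfolding C_def
  proof (rule bounded_holomorphic_lipschitz[OF \<open>r > 0\<close> _ _ that(2,3)])
    fix x assume x: "x \<in> ball e r"
    show "norm (m (p, x)) \<le> B" by (rule mB[OF that(1) x])
    have lin: "m' (p, x) (a *s 0, a *s q) = a *s m' (p, x) (0, q)" for a q
      using m'[OF that(1) x] by blast
    have "(m has_derivative m' (p, x)) (at (p, x))" using m'[OF that(1) x] by blast
    from has_derivative_compose[OF has_derivative_Pair[OF has_derivative_const has_derivative_ident] this]
    have "((\<lambda>x. m (p, x)) has_derivative (\<lambda>q. m' (p, x) (0, q))) (at x)" .
    then show "((\<lambda>x. m (p, x)) has_derivative (\<lambda>q. m' (p, x) (0, q))) (at x) \<and> 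
       (\<forall>a q. m' (p, x) (0, a *s q) = a *s m' (p, x) (0, q))" using lin by simp
  qed
  have cd: "has_cderiv (\<lambda>t. m (e + t *s \<eta> z, v)) (m' (e + t *s \<eta> z, v) (\<eta> z, 0)) t"
    if "t \<in> ball 0 s" "z \<in> ball z0 (R/2)" "v \<in> ball e r" for t z v
    using m'[OF in_ball[OF that(1,2)] that(3)]
    by (intro has_cderiv_compose2[of m _ "\<lambda>t. e + t *s \<eta> z"]) 
       (auto simp: has_cderiv_iff intro!: derivative_eq_intros)
  have cd0: "has_cderiv (\<lambda>t. m (e + t *s \<eta> z, v)) (G z v) 0"
    if "z \<in> ball z0 (R/2)" "v \<in> ball e r" for z v
    using cd[of 0 z v] that \<open>s > 0\<close> by (simp add: G_def)
  \<comment> \<open>\<open>G z v\<close> is the derivative at \<open>t = 0\<close> of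
    \<open>t \<mapsto> m (e + t *s \<eta> z, v)\<close>. The remainder bound is independent of
    \<open>z\<close> and \<open>v\<close>, as uniform convergence of the difference quotients
    requires.\<close>
  have expand: "norm (m (e + t *s \<eta> z, v) - m (e, v) - t *s G z v) 
        \<le> CARD('n) * (32 * B / s\<^sup>2 * (norm t)\<^sup>2)"
    if "z \<in> ball z0 (R/2)" "v \<in> ball e r" "t \<in> ball 0 (s/2)" for z v t
    using cauchy_estimate_vec(2)[OF \<open>s > 0\<close>, of "\<lambda>t. m (e + t *s \<eta> z, v)" B "G z v" t] 
      cd cd0 in_ball mB that by auto
  have ex: "\<exists>u \<delta>. 0 < \<delta> \<and> \<delta> \<le> R/2 \<and> u z0 = e \<and>
     (\<forall>z\<in>ball z0 \<delta>. u z \<in> ball e (r/2) \<and> has_cderiv u (G z (u z)) z)"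
  proof (rule holomorphic_initial_value_problem[where R = "R/2" and \<rho> = "r/2" and e = e and ?z0.0 = z0
            and K = "CARD('n) * (2 * B / s)" and L = "CARD('n) * (2 * C / s)" and G = G])
    fix z v assume z: "z \<in> ball z0 (R/2)" and v: "v \<in> ball e (r/2)"
    show "norm (G z v) \<le> CARD('n) * (2 * B / s)"
      using cauchy_estimate_vec(1)[OF \<open>s > 0\<close>, of "\<lambda>t. m (e + t *s \<eta> z, v)" B "G z v"] 
        cd[OF _ z half[OF v]] cd0[OF z half[OF v]] in_ball[OF _ z] mB[OF _ half[OF v]] by blast
    fix w assume w: "w \<in> ball e (r/2)"
    \<comment> \<open>Cauchy's estimate is applied to the difference of the two curves belonging to
      \<open>v\<close> and \<open>w\<close>. Its values are at most \<open>C * norm (v - w)\<close>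
      by \<open>mC\<close>, so its derivative at 0 inherits the Lipschitz dependence of
      \<open>m\<close>.\<close>
    have "norm (G z v - G z w) \<le> CARD('n) * (2 * (C * norm (v - w)) / s)"
    proof (rule cauchy_estimate_vec(1)[OF \<open>s > 0\<close>])
      show "has_cderiv (\<lambda>t. m (e + t *s \<eta> z, v) - m (e + t *s \<eta> z, w)) (G z v - G z w) 0"
        by (intro has_cderiv_diff cd0 z half v w)
      show "\<exists>d. has_cderiv (\<lambda>t. m (e + t *s \<eta> z, v) - m (e + t *s \<eta> z, w)) d t" 
        if "t \<in> ball 0 s" for t
        using has_cderiv_diff[OF cd[OF that z half[OF v]] cd[OF that z half[OF w]]] by blast
    qed (use mC in_ball z v w in auto)
    then show "norm (G z v - G z w) \<le> CARD('n) * (2 * C / s) * norm (v - w)"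
      by (simp add: mult_ac)
  next
    fix u \<delta> and k :: 'n
    assume "\<delta> \<le> R/2" and u: "\<And>z. z \<in> ball z0 \<delta> \<Longrightarrow> u z \<in> ball e (r/2) \<and> (\<exists>v. has_cderiv u v z)"
    obtain n0 :: nat where n0: "n0 > 0" "1 / n0 < s / 2"
      using nat_approx_posE[of "s/2"] \<open>s > 0\<close> by (metis half_gt_zero of_nat_Suc zero_less_Suc)
    \<comment> \<open>A null sequence of nonzero increments; the offset \<open>n0\<close> puts even
      its first term into the disc of radius \<open>s / 2\<close> where \<open>expand\<close>
      holds.\<close>
    define \<tau> :: "nat \<Rightarrow> complex" where "\<tau> n = 1 / of_nat (n + n0)" for n
    have \<tau>: "\<tau> n \<in> ball 0 (s/2)" "\<tau> n \<noteq> (0::complex)" for n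
    proof -
      have "1 / real (n + n0) \<le> 1 / n0" using n0 by (simp add: frac_le)
      then show "\<tau> n \<in> ball 0 (s/2)" using n0 by (simp add: \<tau>_def norm_divide del: of_nat_add)
    qed (use n0 in \<open>simp add: \<tau>_def del: of_nat_add\<close>)
    have zR: "z \<in> ball z0 (R/2)" if "z \<in> ball z0 \<delta>" for z using that \<open>\<delta> \<le> R/2\<close> by simp
    \<comment> \<open>Nothing is known about how \<open>m'\<close> depends on its base point, so
      holomorphy of \<open>z \<mapsto> G z (u z)\<close> cannot be had by composition. These
      difference quotients involve only \<open>m\<close> and are therefore holomorphic; their
      uniform limit is the required function.\<close>
    let ?g = "\<lambda>n z. (m (e + \<tau> n *s \<eta> z, u z) $ k - m (e, u z) $ k) / \<tau> n"
    show "(\<lambda>z. G z (u z) $ k) holomorphic_on ball z0 \<delta>"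
    proof (rule holomorphic_uniform_sequence[where f = ?g])
      show "?g n holomorphic_on ball z0 \<delta>" for n
      proof -
        have hm: "(\<lambda>z. m (e + t *s \<eta> z, u z) $ k) holomorphic_on ball z0 \<delta>" 
          if "t \<in> ball 0 s" for t
        proof (rule has_cderiv_imp_holomorphic)
          fix z assume z: "z \<in> ball z0 \<delta>"
          obtain v where v: "has_cderiv u v z" "u z \<in> ball e (r/2)" using u[OF z] by blast
          have "((\<lambda>z. \<eta> z $ k) has_field_derivative deriv (\<lambda>z. \<eta> z $ k) z) (at z)" for k
            using \<eta>[of k] zR[OF z] \<open>R > 0\<close> by (intro holomorphic_derivI[of _ "ball z0 R"]) auto
          then have "has_cderiv (\<lambda>z. e + t *s \<eta> z) (t *s (\<chi> k. deriv (\<lambda>z. \<eta> z $ k) z)) z"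
            by (auto simp: has_cderiv_iff intro!: derivative_eq_intros)
          then have "has_cderiv (\<lambda>z. m (e + t *s \<eta> z, u z)) 
              (m' (e + t *s \<eta> z, u z) (t *s (\<chi> k. deriv (\<lambda>z. \<eta> z $ k) z), v)) z"
            using m'[OF in_ball[OF that zR[OF z]] half[OF v(2)]] v(1) 
            by (intro has_cderiv_compose2[of m _ "\<lambda>z. e + t *s \<eta> z" z u]) auto
          then show "\<exists>d. has_cderiv (\<lambda>z. m (e + t *s \<eta> z, u z)) d z" ..
        qed
        from hm[of "\<tau> n"] hm[of 0] \<tau>[of n] \<open>s > 0\<close> show ?thesis
          by (intro holomorphic_intros) auto
      qed
      fix x assume "x \<in> ball z0 \<delta>"
      then obtain d where d: "d > 0" "cball x d \<subseteq> ball z0 \<delta>"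
        using open_contains_cball_eq[of "ball z0 \<delta>"] by auto
      have "uniform_limit (ball z0 \<delta>) ?g (\<lambda>z. G z (u z) $ k) sequentially"
      proof (rule uniform_limitI)
        fix \<epsilon> :: real assume "\<epsilon> > 0"
        let ?D = "CARD('n) * (32 * B / s\<^sup>2)"
        have "(\<lambda>n. ?D * norm (\<tau> n :: complex)) \<longlonglongrightarrow> ?D * norm (0::complex)"
        proof (intro tendsto_mult tendsto_norm tendsto_const)
          have "(\<lambda>n. 1 / of_nat n :: complex) \<longlonglongrightarrow> 0" by (rule lim_1_over_n)
          then show "\<tau> \<longlonglongrightarrow> (0::complex)" unfolding \<tau>_def by (rule LIMSEQ_ignore_initial_segment)
        qed
        then have "\<forall>\<^sub>F n in sequentially. ?D * norm (\<tau> n :: complex) < \<epsilon>"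
          using \<open>\<epsilon> > 0\<close> by (auto dest: order_tendstoD(2))
        then show "\<forall>\<^sub>F n in sequentially. \<forall>z\<in>ball z0 \<delta>. dist (?g n z) (G z (u z) $ k) < \<epsilon>"
        proof (eventually_elim, intro ballI)
          fix n z assume n: "?D * norm (\<tau> n :: complex) < \<epsilon>" and z: "z \<in> ball z0 \<delta>"
          let ?d = "m (e + \<tau> n *s \<eta> z, u z) - m (e, u z) - \<tau> n *s G z (u z)"
          have "dist (?g n z) (G z (u z) $ k) = norm (?d $ k) / norm (\<tau> n)"
            using \<tau>(2)[of n] by (simp add: dist_norm norm_divide[symmetric] diff_divide_distrib)
          also have "\<dots> \<le> (?D * (norm (\<tau> n))\<^sup>2) / norm (\<tau> n)"
          proof (rule divide_right_mono)
            have "norm ?d \<le> ?D * (norm (\<tau> n))\<^sup>2"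
              using expand[OF zR[OF z] half \<tau>(1)] u[OF z] by (simp add: mult.assoc)
            then show "norm (?d $ k) \<le> ?D * (norm (\<tau> n))\<^sup>2"
              by (rule order_trans[OF Finite_Cartesian_Product.norm_nth_le])
          qed simp
          also have "\<dots> = ?D * norm (\<tau> n)" using \<tau>(2)[of n] by (simp add: power2_eq_square)
          finally show "dist (?g n z) (G z (u z) $ k) < \<epsilon>" using n by simp
        qed
      qed
      then show "\<exists>d>0. cball x d \<subseteq> ball z0 \<delta> \<and> 
          uniform_limit (cball x d) ?g (\<lambda>z. G z (u z) $ k) sequentially"
        using d by (intro exI[of _ d] conjI) (auto intro: uniform_limit_on_subset)
    qed simp
  next
    fix u \<delta>
    assume "0 < \<delta>" "\<delta> \<le> R/2" "u z0 = e"
      "\<And>z. z \<in> ball z0 \<delta> \<Longrightarrow> u z \<in> ball e (r/2) \<and> has_cderiv u (G z (u z)) z"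
    then show ?thesis by (intro exI[of _ u] exI[of _ \<delta>]) blast
  qed (use \<open>r > 0\<close> \<open>R > 0\<close> in auto)
  from ex obtain u \<delta> where "0 < \<delta>" "\<delta> \<le> R/2" "u z0 = e"
     "\<And>z. z \<in> ball z0 \<delta> \<Longrightarrow> u z \<in> ball e (r/2) \<and> has_cderiv u (G z (u z)) z" by blast
  then show thesis using \<open>R > 0\<close> half by (intro that[of \<delta> u]) (auto simp: G_def)
qed

section \<open>Gluing over contractible sets\<close>

text \<open>Open boxes form a basis of the product topology. They let the time and the point vary
  independently in a homotopy that is continuous only relative to its domain.\<close>

lemma continuous_on_box_preimage:
  fixes h :: "'s::topological_space \<times> 'b::topological_space \<Rightarrow> 'c::topological_space"
  assumes "continuous_on (T \<times> U) h" "open V" "t \<in> T" "x \<in> U" "h (t, x) \<in> V"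
  obtains A B where "open A" "open B" "t \<in> A" "x \<in> B" "\<And>r y. r \<in> A \<inter> T \<Longrightarrow> y \<in> B \<inter> U \<Longrightarrow> h (r, y) \<in> V"
proof -
  obtain W where W: "open W" "W \<inter> (T \<times> U) = h -` V \<inter> (T \<times> U)"
    using assms(1,2) by (meson continuous_on_open_invariant)
  then have "(t, x) \<in> W" using assms by blast
  then obtain A B where "open A" "open B" "t \<in> A" "x \<in> B" "A \<times> B \<subseteq> W"
    using W(1) by (metis mem_Sigma_iff open_prod_elim)
  then show thesis using W(2) by (intro that[of A B]) auto
qed

text \<open>The homotopy is reversed so that it runs from a constant map to the identity: lifts then
  share the starting point \<open>a\<close>, and the track of \<open>x\<close> ends at
  \<open>x\<close>.\<close>

lemma contractible_homotopy:
  fixes U :: "'a::topological_space set"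
  assumes "contractible U" "U \<noteq> {}"
  obtains a and h :: "real \<times> 'a \<Rightarrow> 'a" where "a \<in> U" "continuous_on ({0..1} \<times> U) h" "h \<in> {0..1} \<times> U \<rightarrow> U" 
     "\<And>x. x \<in> U \<Longrightarrow> h (0, x) = a" "\<And>x. x \<in> U \<Longrightarrow> h (1, x) = x"
proof -
  obtain a where "homotopic_with_canon (\<lambda>x. True) U U id (\<lambda>x. a)"
    using \<open>contractible U\<close> unfolding contractible_def by (elim exE)
  then have "homotopic_with_canon (\<lambda>x. True) U U (\<lambda>x. a) id" by (rule homotopic_with_symD)
  then obtain h where h: "continuous_map (prod_topology (top_of_set {0..1::real}) (top_of_set U)) (top_of_set U) h" 
    "\<And>x. h (0, x) = a" "\<And>x. h (1, x) = x"
    unfolding homotopic_with_def id_def by (elim exE conjE) simp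
  from h(1) have h1: "continuous_on ({0..1} \<times> U) h" "h \<in> {0..1} \<times> U \<rightarrow> U" by simp_all
  obtain x where "x \<in> U" using assms by blast
  then have "h (0, x) \<in> U" using h1(2) by auto
  then show thesis using that[of a h] h(2,3) h1 by simp
qed

text \<open>A continuous homotopy contracting \<open>U\<close> to a point carries the local sections along: the
  horizontal lifts starting at a fixed value exist and are unique over each track of the homotopy,
  and their end points form the global section.\<close>

lemma global_section_contractible:
  fixes U :: "'a::topological_space set" and S :: "'a set \<Rightarrow> ('a \<Rightarrow> 'g) \<Rightarrow> bool"
  assumes "contractible U"
    and ext: "\<And>x. x \<in> U \<Longrightarrow> \<exists>V. open V \<and> x \<in> V \<and> (\<forall>y\<in>V. \<forall>g. \<exists>\<psi>. S V \<psi> \<and> \<psi> y = g)"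
    and uniq: "\<And>V W \<psi> \<psi>' x. S V \<psi> \<Longrightarrow> S W \<psi>' \<Longrightarrow> x \<in> V \<inter> W \<Longrightarrow>
      \<exists>N. open N \<and> x \<in> N \<and> N \<subseteq> V \<inter> W \<and> (\<forall>y\<in>N. \<psi> y = \<psi>' y \<longleftrightarrow> \<psi> x = \<psi>' x)"
  obtains f where "\<And>x. x \<in> U \<Longrightarrow> 
      \<exists>V \<psi> N. S V \<psi> \<and> open N \<and> x \<in> N \<and> N \<inter> U \<subseteq> V \<and> (\<forall>y\<in>N \<inter> U. f y = \<psi> y)"
proof (cases "U = {}")
  case True
  then show thesis by (intro that) simp
next
  case False
  obtain a and h :: "real \<times> 'a \<Rightarrow> 'a" where "a \<in> U" and cont: "continuous_on ({0..1} \<times> U) h" 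
    and h_in: "h \<in> {0..1} \<times> U \<rightarrow> U" 
    and h0: "\<And>x. x \<in> U \<Longrightarrow> h (0, x) = a" and h1: "\<And>x. x \<in> U \<Longrightarrow> h (1, x) = x"
    by (rule contractible_homotopy[OF \<open>contractible U\<close> False]) (rule that)
  have hU: "h (t, x) \<in> U" if "t \<in> {0..1}" "x \<in> U" for t x using h_in that by auto
  \<comment> \<open>\<open>F\<close> is a horizontal lift of \<open>h\<close> over \<open>T\<close>:
    near each point of \<open>T\<close> it is one local section composed with \<open>h\<close>. The
    neighbourhood \<open>W\<close> is taken in the product, so horizontality is demanded in time and
    space together.\<close>
  define hor where "hor T F \<longleftrightarrow> (\<forall>q\<in>T. \<exists>V \<psi> W. S V \<psi> \<and> open W \<and> q \<in> W \<and> 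
     (\<forall>q'\<in>W \<inter> T. h q' \<in> V \<and> F q' = \<psi> (h q')))" for T and F :: "real \<times> 'a \<Rightarrow> 'g"
  have horE: "\<exists>V \<psi> W. S V \<psi> \<and> open W \<and> q \<in> W \<and> (\<forall>q'\<in>W \<inter> T. h q' \<in> V \<and> F q' = \<psi> (h q'))"
    if "hor T F" "q \<in> T" for T F q
    by (rule bspec[OF that(1)[unfolded hor_def] that(2)])
  have hor_mono: "hor T' F" if mono: "hor T F" "T' \<subseteq> T" for T T' F
    unfolding hor_def
  proof
    fix q assume "q \<in> T'"
    then have "q \<in> T" using mono(2) by (rule rev_subsetD)
    from horE[OF mono(1) this] obtain V \<psi> W 
      where W: "S V \<psi>" "open W" "q \<in> W" "\<forall>q'\<in>W \<inter> T. h q' \<in> V \<and> F q' = \<psi> (h q')"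
      by (elim exE conjE) (rule that)
    from W(4) have "\<forall>q'\<in>W \<inter> T'. h q' \<in> V \<and> F q' = \<psi> (h q')"
      using mono(2) by auto
    with W(1-3) show "\<exists>V \<psi> W. S V \<psi> \<and> open W \<and> q \<in> W \<and> (\<forall>q'\<in>W \<inter> T'. h q' \<in> V \<and> F q' = \<psi> (h q'))"
      by (intro exI[of _ V] exI[of _ \<psi>] exI[of _ W] conjI)
  qed
  \<comment> \<open>Any common starting value over \<open>a\<close> would do.\<close>
  define g0 :: 'g where "g0 = undefined"
  have lift: "\<exists>N F. open N \<and> x \<in> N \<and> hor ({0..1} \<times> (N \<inter> U)) F \<and> (\<forall>y\<in>N \<inter> U. F (0, y) = g0)" 
    if x: "x \<in> U" for x
  proof -
    \<comment> \<open>The neighbourhood \<open>N\<close> of \<open>x\<close> may depend on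
      \<open>s\<close>, so it is allowed to shrink while the lift is prolonged in time.\<close>
    define good where "good s \<longleftrightarrow> (\<exists>N F. open N \<and> x \<in> N \<and> hor ({0..s} \<times> (N \<inter> U)) F \<and> 
        (\<forall>y\<in>N \<inter> U. F (0, y) = g0))" for s
    have goodI: "good s" if "open N" "x \<in> N" "hor ({0..s} \<times> (N \<inter> U)) F" "\<And>y. y \<in> N \<inter> U \<Longrightarrow> F (0, y) = g0" for s N F
      unfolding good_def by (intro exI[of _ N] exI[of _ F] conjI ballI that)
    have goodE: thesis if "good s" "\<And>N F. open N \<Longrightarrow> x \<in> N \<Longrightarrow> hor ({0..s} \<times> (N \<inter> U)) F \<Longrightarrow> 
        (\<And>y. y \<in> N \<inter> U \<Longrightarrow> F (0, y) = g0) \<Longrightarrow> thesis" for s thesis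
      using that(1) unfolding good_def by (elim exE conjE) (rule that(2), assumption+, erule (1) bspec)
    have "good 0"
    proof -
      obtain V \<psi> where V: "a \<in> V" "S V \<psi>" "\<psi> a = g0" using ext[OF \<open>a \<in> U\<close>] by blast
      have "hor ({0..0} \<times> (UNIV \<inter> U)) (\<lambda>_. g0)"
        unfolding hor_def 
        by (intro ballI exI[of _ V] exI[of _ \<psi>] exI[of _ UNIV]) (use V h0 in auto)
      then show ?thesis by (intro goodI[of UNIV 0 "\<lambda>_. g0"]) auto
    qed
    \<comment> \<open>Near \<open>t0\<close> the tracks of the points close to \<open>x\<close> stay
      in a single set \<open>V\<close> on which sections with any prescribed value exist. Hence all
      times near \<open>t0\<close> are good or none is, which replaces separate openness and
      closedness arguments.\<close>
    have extend: "\<exists>A. open A \<and> t0 \<in> A \<and> (\<forall>s\<in>A \<inter> {0..1}. \<forall>t\<in>A \<inter> {0..1}. good s \<longrightarrow> good t)"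
      if t0: "t0 \<in> {0..1}" for t0
    proof -
      obtain V where V: "open V" "h (t0, x) \<in> V" "\<And>y g. y \<in> V \<Longrightarrow> \<exists>\<psi>. S V \<psi> \<and> \<psi> y = g"
        using ext[OF hU[OF t0 x]] by blast
      obtain A0 B where AB: "open A0" "open B" "t0 \<in> A0" "x \<in> B" 
        "\<And>r y. r \<in> A0 \<inter> {0..1} \<Longrightarrow> y \<in> B \<inter> U \<Longrightarrow> h (r, y) \<in> V"
        by (rule continuous_on_box_preimage[OF cont V(1) t0 x V(2)]) (rule that)
      obtain \<epsilon> where \<epsilon>: "\<epsilon> > 0" "ball t0 \<epsilon> \<subseteq> A0" using AB openE by blast
      have step: "good t" if s: "s \<in> ball t0 \<epsilon> \<inter> {0..1}" and t: "t \<in> ball t0 \<epsilon> \<inter> {0..1}" and "good s" for s t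
      proof (cases "t \<le> s")
        case True
        show ?thesis
        proof (rule goodE[OF \<open>good s\<close>])
          fix N F assume *: "open N" "x \<in> N" "hor ({0..s} \<times> (N \<inter> U)) F" 
            "\<And>y. y \<in> N \<inter> U \<Longrightarrow> F (0, y) = g0"
          show "good t" by (rule goodI[OF *(1,2) hor_mono[OF *(3)] *(4)]) (use True in auto)
        qed
      next
        case False
        obtain N F where N: "open N" "x \<in> N" and F: "hor ({0..s} \<times> (N \<inter> U)) F" 
          and F0: "\<And>y. y \<in> N \<inter> U \<Longrightarrow> F (0, y) = g0" 
          by (rule goodE[OF \<open>good s\<close>]) (rule that)
        have mid: "r \<in> A0" if "s \<le> r" "r \<le> t" for r
        proof -
          have "r \<in> ball t0 \<epsilon>" using s t that by (auto simp: dist_real_def)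
          then show ?thesis using \<epsilon> by blast
        qed
        have inV: "h (r, y) \<in> V" if "s \<le> r" "r \<le> t" "y \<in> B \<inter> U" for r y
          using AB(5)[of r y] mid[OF that(1,2)] that s t by auto
        obtain \<psi> where \<psi>: "S V \<psi>" "\<psi> (h (s, x)) = F (s, x)"
          using V(3)[OF inV[of s x], of "F (s, x)"] AB(4) x False by auto
        \<comment> \<open>Near \<open>(s, y)\<close> the lift \<open>F\<close> is given by some
          section \<open>\<psi>'\<close>, and by \<open>uniq\<close> whether \<open>\<psi>'\<close>
          coincides with the prolonging section \<open>\<psi>\<close> throughout \<open>N'\<close>
          is decided by the single comparison at \<open>(s, y)\<close>.\<close>
        have loc: thesis
          if y: "y \<in> N \<inter> B \<inter> U" 
            and locI: "\<And>V' \<psi>' O1 O2 N'. S V' \<psi>' \<Longrightarrow> open O1 \<Longrightarrow> open O2 \<Longrightarrow> s \<in> O1 \<Longrightarrow> y \<in> O2 \<Longrightarrow>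
              N' \<subseteq> V' \<inter> V \<Longrightarrow> 
              (\<And>w. w \<in> N' \<Longrightarrow> \<psi>' w = \<psi> w \<longleftrightarrow> F (s, y) = \<psi> (h (s, y))) \<Longrightarrow>
              (\<And>r w. r \<in> O1 \<Longrightarrow> w \<in> O2 \<inter> N \<inter> U \<Longrightarrow> r \<in> {0..s} \<Longrightarrow> F (r, w) = \<psi>' (h (r, w))) \<Longrightarrow>
              (\<And>r w. r \<in> O1 \<Longrightarrow> w \<in> O2 \<inter> U \<Longrightarrow> r \<in> {0..1} \<Longrightarrow> h (r, w) \<in> N') \<Longrightarrow> thesis" 
          for y thesis
        proof -
          obtain V' \<psi>' W where W: "S V' \<psi>'" "open W" "(s, y) \<in> W" 
            "\<And>q. q \<in> W \<inter> {0..s} \<times> (N \<inter> U) \<Longrightarrow> h q \<in> V' \<and> F q = \<psi>' (h q)"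
            using horE[OF F, of "(s, y)"] s y by auto
          have Fs: "F (s, y) = \<psi>' (h (s, y))" "h (s, y) \<in> V'" using W(3,4) s y by auto
          have "h (s, y) \<in> V' \<inter> V" using Fs inV[of s y] False y by auto
          from uniq[OF W(1) \<psi>(1) this] obtain N' where N': "open N'" "h (s, y) \<in> N'" "N' \<subseteq> V' \<inter> V"
            "\<And>w. w \<in> N' \<Longrightarrow> \<psi>' w = \<psi> w \<longleftrightarrow> \<psi>' (h (s, y)) = \<psi> (h (s, y))" 
            by (elim exE conjE) (rule that, assumption+, erule (1) bspec)
          have sy: "s \<in> {0..1}" "y \<in> U" using s y by auto
          obtain C1 C2 where C: "open C1" "open C2" "s \<in> C1" "y \<in> C2" 
            "\<And>r w. r \<in> C1 \<inter> {0..1} \<Longrightarrow> w \<in> C2 \<inter> U \<Longrightarrow> h (r, w) \<in> N'"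
            by (rule continuous_on_box_preimage[OF cont N'(1) sy N'(2)]) (rule that)
          obtain D1 D2 where D: "open D1" "open D2" "s \<in> D1" "y \<in> D2" "D1 \<times> D2 \<subseteq> W"
            using open_prod_elim[OF W(2,3)] by (metis mem_Sigma_iff)
          show thesis
          proof (rule locI[of V' \<psi>' "C1 \<inter> D1" "C2 \<inter> D2" N'])
            fix r w assume r: "r \<in> C1 \<inter> D1" "w \<in> C2 \<inter> D2 \<inter> N \<inter> U" "r \<in> {0..s}"
            then have "(r, w) \<in> W \<inter> {0..s} \<times> (N \<inter> U)" using D(5) by auto
            then show "F (r, w) = \<psi>' (h (r, w))" using W(4) by blast
          next
            fix w assume "w \<in> N'"
            then show "\<psi>' w = \<psi> w \<longleftrightarrow> F (s, y) = \<psi> (h (s, y))" using N'(4) Fs(1) by simp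
          qed (use W(1) C D N'(3) in \<open>auto intro: open_Int\<close>)
        qed
        obtain V1 \<psi>1 O1 O2 N1 where "S V1 \<psi>1" "open O1" and O: "open O2" "s \<in> O1" "x \<in> O2" 
            "N1 \<subseteq> V1 \<inter> V" "\<And>w. w \<in> N1 \<Longrightarrow> \<psi>1 w = \<psi> w \<longleftrightarrow> F (s, x) = \<psi> (h (s, x))"
            "\<And>r w. r \<in> O1 \<Longrightarrow> w \<in> O2 \<inter> N \<inter> U \<Longrightarrow> r \<in> {0..s} \<Longrightarrow> F (r, w) = \<psi>1 (h (r, w))"
            "\<And>r w. r \<in> O1 \<Longrightarrow> w \<in> O2 \<inter> U \<Longrightarrow> r \<in> {0..1} \<Longrightarrow> h (r, w) \<in> N1"
          by (rule loc[of x]) (use N AB x in blast, rule that)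
        \<comment> \<open>The section \<open>\<psi>\<close> was fitted to \<open>F\<close> at
          \<open>(s, x)\<close> only. Within \<open>O2\<close> that agreement spreads to all points
          at time \<open>s\<close>, and within \<open>B\<close> the tracks remain in
          \<open>V\<close> from time \<open>s\<close> to time \<open>t\<close>.\<close>
        define N' where "N' = N \<inter> O2 \<inter> B"
        have Fs: "F (s, y) = \<psi> (h (s, y))" if "y \<in> N' \<inter> U" for y
          using O(5)[of "h (s, y)"] O(6)[of s y] O(7)[of s y] O(2) s \<psi>(2) that by (simp add: N'_def)
        define F' where "F' q = (if fst q \<le> s then F q else \<psi> (h q))" for q
        have "hor ({0..t} \<times> (N' \<inter> U)) F'"
          unfolding hor_def
        proof (intro ballI)
          fix q assume q: "q \<in> {0..t} \<times> (N' \<inter> U)"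
          obtain r y where q_eq: "q = (r, y)" by (cases q)
          consider "r < s" | "r = s" | "r > s" by linarith
          then show "\<exists>V \<psi> W. S V \<psi> \<and> open W \<and> q \<in> W \<and> 
              (\<forall>q'\<in>W \<inter> {0..t} \<times> (N' \<inter> U). h q' \<in> V \<and> F' q' = \<psi> (h q'))"
          proof cases
            case 1
            then have "q \<in> {0..s} \<times> (N \<inter> U)" using q q_eq by (auto simp: N'_def)
            from horE[OF F this] obtain V2 \<psi>2 W where W: "S V2 \<psi>2" "open W" "q \<in> W"
              "\<forall>q'\<in>W \<inter> {0..s} \<times> (N \<inter> U). h q' \<in> V2 \<and> F q' = \<psi>2 (h q')"
              by (elim exE conjE) (rule that)
            show ?thesis
              by (rule exI[of _ V2], rule exI[of _ \<psi>2], rule exI[of _ "W \<inter> ({..<s} \<times> UNIV)"])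
                 (use W 1 q_eq in \<open>auto simp: F'_def N'_def intro!: open_Int open_Times\<close>)
          next
            case 3
            show ?thesis
              by (rule exI[of _ V], rule exI[of _ \<psi>], rule exI[of _ "{s<..} \<times> UNIV"])
                 (use \<psi>(1) 3 q_eq inV in \<open>auto simp: F'_def N'_def intro!: open_Times\<close>)
          next
            \<comment> \<open>At the junction a neighbourhood meets both halves of
              \<open>F'\<close>. The section \<open>\<psi>2\<close> that represents \<open>F\<close>
              there coincides with \<open>\<psi>\<close> on \<open>N2\<close> and so represents both
              halves at once.\<close>
            case 2
            then have y: "y \<in> N' \<inter> U" using q q_eq by auto
            then have yB: "y \<in> N \<inter> B \<inter> U" by (auto simp: N'_def)
            obtain V2 \<psi>2 P1 P2 N2 where P: "S V2 \<psi>2" "open P1" "open P2" "s \<in> P1" "y \<in> P2"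
              "N2 \<subseteq> V2 \<inter> V" "\<And>w. w \<in> N2 \<Longrightarrow> \<psi>2 w = \<psi> w \<longleftrightarrow> F (s, y) = \<psi> (h (s, y))"
              "\<And>r w. r \<in> P1 \<Longrightarrow> w \<in> P2 \<inter> N \<inter> U \<Longrightarrow> r \<in> {0..s} \<Longrightarrow> F (r, w) = \<psi>2 (h (r, w))"
              "\<And>r w. r \<in> P1 \<Longrightarrow> w \<in> P2 \<inter> U \<Longrightarrow> r \<in> {0..1} \<Longrightarrow> h (r, w) \<in> N2"
              by (rule loc[OF yB]) (rule that)
            have t1: "r \<le> 1" if "r \<le> t" for r using that t by auto
            show ?thesis
            proof (rule exI[of _ V2], rule exI[of _ \<psi>2], rule exI[of _ "P1 \<times> P2"], intro conjI ballI)
              fix q' assume q': "q' \<in> (P1 \<times> P2) \<inter> {0..t} \<times> (N' \<inter> U)"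
              then obtain r' y' where q'_eq: "q' = (r', y')" by (cases q')
              have N2: "h q' \<in> N2" using P(9)[of r' y'] q' q'_eq t1 by (auto simp: N'_def)
              then show "h q' \<in> V2" using P(6) by blast
              show "F' q' = \<psi>2 (h q')" 
                using P(7)[OF N2] Fs[OF y] P(8)[of r' y'] q' q'_eq by (auto simp: F'_def N'_def)
            qed (use P q_eq 2 in \<open>auto intro: open_Times\<close>)
          qed
        qed
        moreover have "open N'" "x \<in> N'" using N O AB by (auto simp: N'_def)
        moreover have "F' (0, y) = g0" if "y \<in> N' \<inter> U" for y 
          using F0[of y] s that by (auto simp: F'_def N'_def)
        ultimately show ?thesis by (intro goodI[of N' t F'])
      qed
      show ?thesis
      proof (intro exI[of _ "ball t0 \<epsilon>"] conjI ballI impI)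
        fix s t assume "s \<in> ball t0 \<epsilon> \<inter> {0..1}" "t \<in> ball t0 \<epsilon> \<inter> {0..1}" "good s"
        then show "good t" by (rule step)
      qed (use \<epsilon>(1) in simp_all)
    qed
    have "good 0 = good 1"
    \<comment> \<open>The truth value of \<open>good\<close> is a locally constant function on the
      connected unit interval.\<close>
    proof (rule connected_local_const[of "{0..1::real}"])
      show "\<forall>s\<in>{0..1}. \<forall>\<^sub>F t in at s within {0..1}. good s = good t"
      proof
        fix s :: real assume s: "s \<in> {0..1}"
        obtain A where A: "open A" "s \<in> A" 
          "\<And>r t. r \<in> A \<inter> {0..1} \<Longrightarrow> t \<in> A \<inter> {0..1} \<Longrightarrow> good r \<Longrightarrow> good t"
          using extend[OF s] by blast
        then show "\<forall>\<^sub>F t in at s within {0..1}. good s = good t"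
          unfolding eventually_at_topological using s by (intro exI[of _ A]) blast
      qed
    qed auto
    then show ?thesis using \<open>good 0\<close> unfolding good_def by blast
  qed
  then obtain N F where N: "\<And>x. x \<in> U \<Longrightarrow> open (N x)" "\<And>x. x \<in> U \<Longrightarrow> x \<in> N x"
    and F: "\<And>x. x \<in> U \<Longrightarrow> hor ({0..1} \<times> (N x \<inter> U)) (F x)" 
    and F0: "\<And>x y. x \<in> U \<Longrightarrow> y \<in> N x \<inter> U \<Longrightarrow> F x (0, y) = g0" by metis
  \<comment> \<open>Along one track the truth value of "the lifts agree at time \<open>t\<close>" is
    locally constant by \<open>uniq\<close>, and it is true at time 0.\<close>
  have unique: "F1 (1, y) = F2 (1, y)" 
    if F12: "hor ({0..1} \<times> {y}) F1" "hor ({0..1} \<times> {y}) F2" "F1 (0, y) = F2 (0, y)" and y: "y \<in> U" for F1 F2 y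
  proof -
    have "(F1 (0, y) = F2 (0, y)) = (F1 (1, y) = F2 (1, y))"
    proof (rule connected_local_const[of "{0..1::real}" _ _ "\<lambda>t. F1 (t, y) = F2 (t, y)"])
      show "\<forall>s\<in>{0..1}. \<forall>\<^sub>F t in at s within {0..1}. 
          (F1 (s, y) = F2 (s, y)) = (F1 (t, y) = F2 (t, y))"
      proof
        fix s :: real assume s: "s \<in> {0..1}"
        obtain V1 \<psi>1 W1 where 1: "S V1 \<psi>1" "open W1" "(s, y) \<in> W1"
          "\<And>q'. q' \<in> W1 \<inter> {0..1} \<times> {y} \<Longrightarrow> h q' \<in> V1 \<and> F1 q' = \<psi>1 (h q')"
          using horE[OF F12(1), of "(s, y)"] s by auto
        obtain V2 \<psi>2 W2 where 2: "S V2 \<psi>2" "open W2" "(s, y) \<in> W2"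
          "\<And>q'. q' \<in> W2 \<inter> {0..1} \<times> {y} \<Longrightarrow> h q' \<in> V2 \<and> F2 q' = \<psi>2 (h q')"
          using horE[OF F12(2), of "(s, y)"] s by auto
        have "h (s, y) \<in> V1 \<inter> V2" using 1 2 s by auto
        from uniq[OF 1(1) 2(1) this] obtain M where M: "open M" "h (s, y) \<in> M"
          "\<And>w. w \<in> M \<Longrightarrow> \<psi>1 w = \<psi>2 w \<longleftrightarrow> \<psi>1 (h (s, y)) = \<psi>2 (h (s, y))" 
          by (elim exE conjE) (rule that, assumption+, erule (1) bspec)
        have cont_y: "continuous_on ({0..1} \<times> {y}) h" 
          by (rule continuous_on_subset[OF cont]) (use y in auto)
        have "y \<in> {y}" by simp
        from continuous_on_box_preimage[OF cont_y M(1) s this M(2)] 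
        obtain A B where A: "open A" "s \<in> A" "y \<in> B" 
            "\<And>r w. r \<in> A \<inter> {0..1} \<Longrightarrow> w \<in> B \<inter> {y} \<Longrightarrow> h (r, w) \<in> M" by metis
        obtain A1 B1 where A1: "open A1" "s \<in> A1" "y \<in> B1" "A1 \<times> B1 \<subseteq> W1"
          using open_prod_elim[OF 1(2,3)] by (metis mem_Sigma_iff)
        obtain A2 B2 where A2: "open A2" "s \<in> A2" "y \<in> B2" "A2 \<times> B2 \<subseteq> W2"
          using open_prod_elim[OF 2(2,3)] by (metis mem_Sigma_iff)
        have eq: "(F1 (t, y) = F2 (t, y)) \<longleftrightarrow> \<psi>1 (h (s, y)) = \<psi>2 (h (s, y))"
          if "t \<in> A \<inter> A1 \<inter> A2" "t \<in> {0..1}" for t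
        proof -
          have "F1 (t, y) = \<psi>1 (h (t, y))" using 1(4)[of "(t, y)"] A1 that by auto
          moreover have "F2 (t, y) = \<psi>2 (h (t, y))" using 2(4)[of "(t, y)"] A2 that by auto
          ultimately show ?thesis using M(3)[OF A(4)[of t y]] A(3) that by auto
        qed
        show "\<forall>\<^sub>F t in at s within {0..1}. (F1 (s, y) = F2 (s, y)) = (F1 (t, y) = F2 (t, y))"
          unfolding eventually_at_topological
          using eq[of s] eq A A1 A2 s by (intro exI[of _ "A \<inter> A1 \<inter> A2"]) auto
      qed
    qed auto
    then show ?thesis using F12(3) by simp
  qed
  \<comment> \<open>Each point uses the lift chosen for itself. On \<open>N x\<close> uniqueness
    replaces all these lifts by the single lift \<open>F x\<close>, which near time 1 is a local
    section composed with \<open>h\<close>, and \<open>h (1, y) = y\<close>.\<close>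
  define f where "f y = F y (1, y)" for y
  show thesis
  proof (rule that)
    fix x assume x: "x \<in> U"
    have fx: "f y = F x (1, y)" if "y \<in> N x \<inter> U" for y
      unfolding f_def
    proof (rule unique)
      show "hor ({0..1} \<times> {y}) (F y)" by (rule hor_mono[OF F]) (use that N in auto)
      show "hor ({0..1} \<times> {y}) (F x)" by (rule hor_mono[OF F]) (use that N x in auto)
      show "F y (0, y) = F x (0, y)" using F0[of y y] F0[of x y] that x N by auto
      show "y \<in> U" using that by simp
    qed
    obtain V \<psi> W where W: "S V \<psi>" "open W" "(1, x) \<in> W"
      "\<And>q'. q' \<in> W \<inter> {0..1} \<times> (N x \<inter> U) \<Longrightarrow> h q' \<in> V \<and> F x q' = \<psi> (h q')"
      using horE[OF F[OF x], of "(1, x)"] x N(2)[OF x] by auto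
    obtain A B where "open A" "open B" "1 \<in> A" "x \<in> B" "A \<times> B \<subseteq> W"
      using open_prod_elim[OF W(2,3)] by (metis mem_Sigma_iff)
    then show "\<exists>V \<psi> N. S V \<psi> \<and> open N \<and> x \<in> N \<and> N \<inter> U \<subseteq> V \<and> (\<forall>y\<in>N \<inter> U. f y = \<psi> y)"
      by (intro exI[of _ V] exI[of _ \<psi>] exI[of _ "B \<inter> N x"])
         (use W(1) W(4)[of "(1, _)"] fx h1 N x in \<open>auto simp: subset_iff\<close>)
  qed
qed

section \<open>Charts\<close>

lemma atlas_chart:
  assumes "atlas H A" "c \<in> A"
  shows atlas_open_domain: "open (fst c)" and atlas_open_image: "open (snd c ` fst c)"
    and atlas_homeomorphism: "homeomorphism (fst c) (snd c ` fst c) (snd c) (chart_inv c)"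
  using assms by (auto simp: atlas_def)

lemma atlas_cover:
  assumes "atlas H A"
  obtains c where "c \<in> A" "x \<in> fst c"
  using assms unfolding atlas_def by blast

lemma atlas_transition:
  "atlas H A \<Longrightarrow> c \<in> A \<Longrightarrow> d \<in> A \<Longrightarrow> H (snd c ` (fst c \<inter> fst d)) (snd d \<circ> chart_inv c)"
  by (auto simp: atlas_def)

lemma chart_inv_chart:
  "atlas H A \<Longrightarrow> c \<in> A \<Longrightarrow> x \<in> fst c \<Longrightarrow> chart_inv c (snd c x) = x"
  using atlas_homeomorphism[of H A c] by (auto simp: homeomorphism_def)

lemma isCont_chart:
  assumes "atlas H A" "c \<in> A" "x \<in> fst c"
  shows "isCont (snd c) x"
  using atlas_homeomorphism[OF assms(1,2)] atlas_open_domain[OF assms(1,2)] assms(3)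
  by (meson homeomorphism_def continuous_on_eq_continuous_at)

lemma isCont_chart_inv:
  assumes "atlas H A" "c \<in> A" "x \<in> fst c"
  shows "isCont (chart_inv c) (snd c x)"
  using atlas_homeomorphism[OF assms(1,2)] atlas_open_image[OF assms(1,2)] assms(3)
  by (meson homeomorphism_def continuous_on_eq_continuous_at imageI)

lemma open_chart_image:
  assumes "atlas H A" "c \<in> A" "open V"
  shows "open (snd c ` (V \<inter> fst c))"
proof -
  have "snd c ` (V \<inter> fst c) = snd c ` fst c \<inter> chart_inv c -` V"
    using chart_inv_chart[OF assms(1,2)] by force
  moreover have "continuous_on (snd c ` fst c) (chart_inv c)"
    using atlas_homeomorphism[OF assms(1,2)] by (simp add: homeomorphism_def)
  ultimately show ?thesis
    using continuous_open_preimage atlas_open_image[OF assms(1,2)] assms(3) by metis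
qed

lemma open_chart_preimage:
  assumes "atlas H A" "c \<in> A" "open V"
  shows "open (fst c \<inter> snd c -` V)"
proof -
  have "continuous_on (fst c) (snd c)"
    using atlas_homeomorphism[OF assms(1,2)] by (simp add: homeomorphism_def)
  then show ?thesis
    using continuous_open_preimage atlas_open_domain[OF assms(1,2)] assms(3) by metis
qed

lemma eventually_chart_inv_in:
  assumes "atlas H A" "c \<in> A" "x \<in> fst c" "open V" "x \<in> V"
  shows "\<forall>\<^sub>F z in nhds (snd c x). chart_inv c z \<in> V \<inter> fst c \<and> snd c (chart_inv c z) = z"
proof -
  have "open (snd c ` (V \<inter> fst c))" by (rule open_chart_image[OF assms(1,2,4)])
  then have "\<forall>\<^sub>F z in nhds (snd c x). z \<in> snd c ` (V \<inter> fst c)"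
    using assms(3,5) by (intro eventually_nhds_in_open) auto
  then show ?thesis
    by eventually_elim (use chart_inv_chart[OF assms(1,2)] in auto)
qed

section \<open>Velocities of holomorphic curves in a Lie group\<close>

text \<open>Chart coordinates are meaningless outside the chart domain. Continuity at
  \<open>z\<close> together with \<open>\<gamma> z \<in> fst d\<close> ensures that the curve stays
  in the domain near \<open>z\<close>, so that the coordinate derivative is a genuine tangent
  vector.\<close>

definition velocity :: "('g::topological_space, complex^'n) chart \<Rightarrow> (complex \<Rightarrow> 'g) \<Rightarrow> complex \<Rightarrow> complex^'n \<Rightarrow> bool" where
  "velocity d \<gamma> z v \<longleftrightarrow> isCont \<gamma> z \<and> \<gamma> z \<in> fst d \<and> has_cderiv (\<lambda>w. snd d (\<gamma> w)) v z"

lemma velocity_unique: "velocity d \<gamma> z v \<Longrightarrow> velocity d \<gamma> z w \<Longrightarrow> v = w"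
  unfolding velocity_def using has_cderiv_unique by blast

lemma velocity_cong:
  assumes "\<forall>\<^sub>F w in nhds z. \<gamma> w = \<delta> w"
  shows "velocity d \<gamma> z v \<longleftrightarrow> velocity d \<delta> z v"
proof -
  have "\<gamma> z = \<delta> z" using assms by (rule eventually_nhds_x_imp_x)
  moreover have "isCont \<gamma> z \<longleftrightarrow> isCont \<delta> z" by (rule isCont_cong[OF assms])
  moreover have "has_cderiv (\<lambda>w. snd d (\<gamma> w)) v z \<longleftrightarrow> has_cderiv (\<lambda>w. snd d (\<delta> w)) v z"
    by (rule has_cderiv_cong) (use assms in \<open>auto elim: eventually_mono\<close>)
  ultimately show ?thesis by (simp add: velocity_def)
qed

lemma velocity_const: "g \<in> fst d \<Longrightarrow> velocity d (\<lambda>_. g) z 0"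
  by (simp add: velocity_def has_cderiv_const)

text \<open>The factor \<open>a\<close> is the one by which the coefficient of a one-form changes
  with the coordinate; this is how a solution found in one chart of the surface is verified in the
  others.\<close>

lemma velocity_reparametrise:
  assumes "velocity d \<gamma> (\<tau> z) v" "(\<tau> has_field_derivative a) (at z)"
  shows "velocity d (\<lambda>w. \<gamma> (\<tau> w)) z (a *s v)"
proof -
  have "isCont \<tau> z" using assms(2) by (rule DERIV_isCont)
  then have "isCont (\<lambda>w. \<gamma> (\<tau> w)) z" using assms(1) isCont_o2 unfolding velocity_def by blast
  then show ?thesis
    using assms has_cderiv_chain[of "\<lambda>w. snd d (\<gamma> w)" v \<tau> z a] by (simp add: velocity_def)
qed

lemma eventually_curve_in:
  assumes "isCont \<gamma> z" "open V" "\<gamma> z \<in> V"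
  shows "\<forall>\<^sub>F w in nhds z. \<gamma> w \<in> V"
  using assms unfolding continuous_at_open eventually_nhds by blast

context complex_lie_group
begin

lemma in_carrier [simp]: "x \<in> carrier G"
  by (simp add: carrier_UNIV)

lemma mult_inv_cancel [simp]: "x \<otimes> inv y \<otimes> y = x" "x \<otimes> y \<otimes> inv y = x"
  by (simp_all add: m_assoc)

lemma isCont_mult:
  assumes "isCont \<gamma> z" "isCont \<delta> z"
  shows "isCont (\<lambda>w. \<gamma> w \<otimes> \<delta> w) z"
proof -
  have "isCont (\<lambda>(g, h). g \<otimes> h) (\<gamma> z, \<delta> z)"
    using continuous_mult by (simp add: continuous_on_eq_continuous_at)
  moreover have "isCont (\<lambda>w. (\<gamma> w, \<delta> w)) z"
    using assms by (rule continuous_Pair)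
  ultimately show ?thesis using isCont_o2[of z "\<lambda>w. (\<gamma> w, \<delta> w)" "\<lambda>(g, h). g \<otimes> h"] by simp
qed

lemma isCont_inverse:
  assumes "isCont \<gamma> z"
  shows "isCont (\<lambda>w. inv (\<gamma> w)) z"
  using assms continuous_inverse by (metis UNIV_I continuous_on_eq_continuous_at isCont_o2 open_UNIV)

lemma velocity_chart_inv:
  assumes "d \<in> A" "has_cderiv f v z" "f z \<in> snd d ` fst d"
  shows "velocity d (\<lambda>w. chart_inv d (f w)) z v"
proof -
  obtain g where g: "g \<in> fst d" "f z = snd d g" using assms(3) by blast
  have cf: "isCont f z" by (rule has_cderiv_isCont[OF assms(2)])
  have cont: "isCont (chart_inv d) (f z)"
    using isCont_chart_inv[OF holomorphic_atlas assms(1) g(1)] g by simp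
  have fz: "chart_inv d (f z) \<in> fst d" 
    using chart_inv_chart[OF holomorphic_atlas assms(1) g(1)] g by simp
  have "\<forall>\<^sub>F w in nhds z. f w \<in> snd d ` fst d"
    by (rule eventually_curve_in[OF cf atlas_open_image[OF holomorphic_atlas assms(1)] assms(3)])
  then have "\<forall>\<^sub>F w in nhds z. snd d (chart_inv d (f w)) = f w"
    by eventually_elim (use chart_inv_chart[OF holomorphic_atlas assms(1)] in auto)
  then show ?thesis
    using has_cderiv_cong[of "\<lambda>w. snd d (chart_inv d (f w))" f z v] assms(2) fz 
      isCont_o2[OF cf cont] by (simp add: velocity_def)
qed

lemma velocity_curve_chart:
  assumes "d \<in> A" "velocity d \<gamma> z v"
  shows "\<forall>\<^sub>F w in nhds z. \<gamma> w \<in> fst d \<and> chart_inv d (snd d (\<gamma> w)) = \<gamma> w"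
proof -
  have "\<forall>\<^sub>F w in nhds z. \<gamma> w \<in> fst d"
    using assms(2) atlas_open_domain[OF holomorphic_atlas assms(1)] 
    by (intro eventually_curve_in) (auto simp: velocity_def)
  then show ?thesis
    by eventually_elim (use chart_inv_chart[OF holomorphic_atlas assms(1)] in auto)
qed

text \<open>\<open>L\<close> is fixed by the charts and the points \<open>g\<close>,
  \<open>h\<close> before any curve is named. It can therefore be evaluated on convenient test
  curves, such as constant ones, and the result used for all curves.\<close>

lemma velocity_mult:
  assumes "c \<in> A" "d \<in> A" "e \<in> A" "g \<in> fst c" "h \<in> fst d" "g \<otimes> h \<in> fst e"
  obtains L where "linear L" and
    "\<And>\<gamma> \<delta> z u v. velocity c \<gamma> z u \<Longrightarrow> velocity d \<delta> z v \<Longrightarrow> \<gamma> z = g \<Longrightarrow> \<delta> z = h \<Longrightarrow> 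
       velocity e (\<lambda>w. \<gamma> w \<otimes> \<delta> w) z (L (u, v))"
proof -
  let ?m = "\<lambda>(u, v). snd e (chart_inv c u \<otimes> chart_inv d v)"
  have "(snd c g, snd d h) \<in> {(snd c g, snd d h) |g h. g \<in> fst c \<and> h \<in> fst d \<and> g \<otimes> h \<in> fst e}"
    using assms(4-6) by blast
  with holomorphic_mult[OF assms(1-3)] obtain L where 
    L: "(?m has_derivative L) (at (snd c g, snd d h))" "\<And>a u v. L (a *s u, a *s v) = a *s L (u, v)"
    unfolding vec_holomorphic_on2_def by blast
  show thesis
  proof (rule that)
    show "linear L" using L(1) has_derivative_linear by blast
    fix \<gamma> \<delta> z u v assume \<gamma>: "velocity c \<gamma> z u" and \<delta>: "velocity d \<delta> z v" and gh: "\<gamma> z = g" "\<delta> z = h"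
    have "has_cderiv (\<lambda>w. ?m (snd c (\<gamma> w), snd d (\<delta> w))) (L (u, v)) z"
      by (rule has_cderiv_compose2[of ?m L "\<lambda>w. snd c (\<gamma> w)" z "\<lambda>w. snd d (\<delta> w)"]) 
         (use L \<gamma> \<delta> gh in \<open>auto simp: velocity_def\<close>)
    moreover have "\<forall>\<^sub>F w in nhds z. ?m (snd c (\<gamma> w), snd d (\<delta> w)) = snd e (\<gamma> w \<otimes> \<delta> w)"
      using velocity_curve_chart[OF assms(1) \<gamma>] velocity_curve_chart[OF assms(2) \<delta>]
      by eventually_elim simp
    ultimately have "has_cderiv (\<lambda>w. snd e (\<gamma> w \<otimes> \<delta> w)) (L (u, v)) z"
      by (rule has_cderiv_transform)
    then show "velocity e (\<lambda>w. \<gamma> w \<otimes> \<delta> w) z (L (u, v))"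
      using \<gamma> \<delta> gh assms(6) isCont_mult[of z \<gamma> \<delta>] by (simp add: velocity_def)
  qed
qed

lemma velocity_mult_ex:
  assumes "c \<in> A" "d \<in> A" "e \<in> A" "velocity c \<gamma> z u" "velocity d \<delta> z v" "\<gamma> z \<otimes> \<delta> z \<in> fst e"
  shows "\<exists>w. velocity e (\<lambda>w. \<gamma> w \<otimes> \<delta> w) z w"
proof -
  have "\<gamma> z \<in> fst c" "\<delta> z \<in> fst d" using assms(4,5) by (auto simp: velocity_def)
  from velocity_mult[OF assms(1-3) this assms(6)] show ?thesis using assms(4,5) by metis
qed

lemma velocity_inverse_ex:
  assumes "c \<in> A" "d \<in> A" "velocity c \<gamma> z u" "inv (\<gamma> z) \<in> fst d"
  shows "\<exists>v. velocity d (\<lambda>w. inv (\<gamma> w)) z v"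
proof -
  let ?i = "\<lambda>u. snd d (inv (chart_inv c u))"
  have \<gamma>: "isCont \<gamma> z" "\<gamma> z \<in> fst c" "has_cderiv (\<lambda>w. snd c (\<gamma> w)) u z"
    using assms(3) by (auto simp: velocity_def)
  have "snd c (\<gamma> z) \<in> {snd c g |g. g \<in> fst c \<and> inv g \<in> fst d}" using \<gamma>(2) assms(4) by blast
  with holomorphic_inverse[OF assms(1,2)] obtain L where 
    L: "(?i has_derivative L) (at (snd c (\<gamma> z)))" "\<And>a v. L (a *s v) = a *s L v"
    unfolding vec_holomorphic_on_def by blast
  have "has_cderiv (\<lambda>w. ?i (snd c (\<gamma> w))) (L u) z"
    by (rule has_cderiv_compose[OF L \<gamma>(3)])
  moreover have "\<forall>\<^sub>F w in nhds z. ?i (snd c (\<gamma> w)) = snd d (inv (\<gamma> w))"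
    using velocity_curve_chart[OF assms(1,3)] by eventually_elim simp
  ultimately have "has_cderiv (\<lambda>w. snd d (inv (\<gamma> w))) (L u) z"
    by (rule has_cderiv_transform)
  then show ?thesis using isCont_inverse[OF \<gamma>(1)] assms(4) by (auto simp: velocity_def)
qed

abbreviation "\<kappa> \<equiv> id_chart G A"

lemma id_chart: "\<kappa> \<in> A" "\<one> \<in> fst \<kappa>"
proof -
  have "\<exists>c. c \<in> A \<and> \<one> \<in> fst c" using atlas_cover[OF holomorphic_atlas] by metis
  then have "\<kappa> \<in> A \<and> \<one> \<in> fst \<kappa>" unfolding id_chart_def by (rule someI_ex)
  then show "\<kappa> \<in> A" "\<one> \<in> fst \<kappa>" by auto
qed

text \<open>The curve is a complex affine line in the coordinates of
  \<open>\<kappa>\<close>.\<close>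

lemma velocity_ex_at_one: 
  obtains \<gamma> where "velocity \<kappa> \<gamma> z v" "\<gamma> z = \<one>"
proof
  let ?f = "\<lambda>w. snd \<kappa> \<one> + (w - z) *s v"
  have "has_cderiv ?f v z" by (auto simp: has_cderiv_iff intro!: derivative_eq_intros)
  then show "velocity \<kappa> (\<lambda>w. chart_inv \<kappa> (?f w)) z v"
    using id_chart by (intro velocity_chart_inv) auto
  show "chart_inv \<kappa> (?f z) = \<one>"
    using chart_inv_chart[OF holomorphic_atlas id_chart] by simp
qed

text \<open>The differential of multiplication at the identity is addition: a constant factor
  \<open>\<one>\<close> leaves a curve unchanged, which gives \<open>L (u, 0) = u\<close> and
  \<open>L (0, v) = v\<close>, and \<open>L\<close> is additive.\<close>

lemma velocity_mult_one:
  assumes "velocity \<kappa> \<gamma> z u" "velocity \<kappa> \<delta> z v" "\<gamma> z = \<one>" "\<delta> z = \<one>"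
  shows "velocity \<kappa> (\<lambda>w. \<gamma> w \<otimes> \<delta> w) z (u + v)"
proof -
  have "\<one> \<otimes> \<one> \<in> fst \<kappa>" using id_chart by simp
  then obtain L where L: "linear L" 
    "\<And>\<gamma> \<delta> z u v. velocity \<kappa> \<gamma> z u \<Longrightarrow> velocity \<kappa> \<delta> z v \<Longrightarrow> \<gamma> z = \<one> \<Longrightarrow> \<delta> z = \<one> \<Longrightarrow> 
       velocity \<kappa> (\<lambda>w. \<gamma> w \<otimes> \<delta> w) z (L (u, v))"
    using velocity_mult[OF id_chart(1) id_chart(1) id_chart(1) id_chart(2) id_chart(2)] by metis
  have "velocity \<kappa> (\<lambda>w. \<gamma> w \<otimes> \<one>) z (L (u, 0))"
    using assms id_chart by (intro L(2) velocity_const) auto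
  then have u: "L (u, 0) = u" using assms(1) velocity_unique by simp blast
  have "velocity \<kappa> (\<lambda>w. \<one> \<otimes> \<delta> w) z (L (0, v))"
    using assms id_chart by (intro L(2) velocity_const) auto
  then have v: "L (0, v) = v" using assms(2) velocity_unique by simp blast
  have "L (u, v) = L ((u, 0) + (0, v))" by simp
  also have "\<dots> = u + v" unfolding linear_add[OF L(1)] u v ..
  finally show ?thesis using L(2)[OF assms] by simp
qed

text \<open>A translation acts linearly on velocities, so zero goes to zero in any chart without its
  differential being computed.\<close>

lemma velocity_zero_mult_const:
  assumes "c \<in> A" "e \<in> A" "velocity c \<gamma> z 0"
  shows "\<gamma> z \<otimes> g \<in> fst e \<Longrightarrow> velocity e (\<lambda>w. \<gamma> w \<otimes> g) z 0"
    and "g \<otimes> \<gamma> z \<in> fst e \<Longrightarrow> velocity e (\<lambda>w. g \<otimes> \<gamma> w) z 0"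
proof -
  obtain d where d: "d \<in> A" "g \<in> fst d" using atlas_cover[OF holomorphic_atlas] by metis
  have \<gamma>: "\<gamma> z \<in> fst c" using assms(3) by (simp add: velocity_def)
  show "velocity e (\<lambda>w. \<gamma> w \<otimes> g) z 0" if e: "\<gamma> z \<otimes> g \<in> fst e"
  proof -
    obtain L where "linear L" and L: "\<And>\<gamma>' \<delta> z' u v. velocity c \<gamma>' z' u \<Longrightarrow> velocity d \<delta> z' v \<Longrightarrow> 
        \<gamma>' z' = \<gamma> z \<Longrightarrow> \<delta> z' = g \<Longrightarrow> velocity e (\<lambda>w. \<gamma>' w \<otimes> \<delta> w) z' (L (u, v))"
      using velocity_mult[OF assms(1) d(1) assms(2) \<gamma> d(2) e] by metis
    then show ?thesis using L[OF assms(3) velocity_const[OF d(2)]] linear_0[of L] 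
      by (simp add: zero_prod_def)
  qed
  show "velocity e (\<lambda>w. g \<otimes> \<gamma> w) z 0" if e: "g \<otimes> \<gamma> z \<in> fst e"
  proof -
    obtain L where "linear L" and L: "\<And>\<gamma>' \<delta> z' u v. velocity d \<gamma>' z' u \<Longrightarrow> velocity c \<delta> z' v \<Longrightarrow> 
        \<gamma>' z' = g \<Longrightarrow> \<delta> z' = \<gamma> z \<Longrightarrow> velocity e (\<lambda>w. \<gamma>' w \<otimes> \<delta> w) z' (L (u, v))"
      using velocity_mult[OF d(1) assms(1) assms(2) d(2) \<gamma> e] by metis
    then show ?thesis using L[OF velocity_const[OF d(2)] assms(3)] linear_0[of L] 
      by (simp add: zero_prod_def)
  qed
qed

text \<open>Let \<open>m\<close> be the group law in the coordinates of \<open>\<kappa>\<close> and \<open>e\<close> the coordinates of the identity. The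
  curve with coordinates \<open>u\<close> has right logarithmic derivative \<open>\<eta>\<close> if \<open>u' = D\<^sub>1m(e, u) \<eta>\<close>.\<close>

lemma local_curve_ex:
  assumes "R > 0" and \<eta>: "\<And>k. (\<lambda>z. \<eta> z $ k) holomorphic_on ball z0 R"
  obtains \<gamma> r where "r > 0" "r \<le> R" 
    "\<And>z. z \<in> ball z0 r \<Longrightarrow> velocity \<kappa> (\<lambda>w. \<gamma> w \<otimes> inv (\<gamma> z)) z (\<eta> z)"
proof -
  define e where "e = snd \<kappa> \<one>"
  let ?m = "\<lambda>(u, v). snd \<kappa> (chart_inv \<kappa> u \<otimes> chart_inv \<kappa> v)"
  note chart = chart_inv_chart[OF holomorphic_atlas id_chart(1)]
  have inv_e: "chart_inv \<kappa> e = \<one>" using chart[OF id_chart(2)] by (simp add: e_def)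
  have c1: "isCont (chart_inv \<kappa>) e"
    using isCont_chart_inv[OF holomorphic_atlas id_chart] by (simp add: e_def)
  have "isCont (\<lambda>p. chart_inv \<kappa> (fst p)) (e, e)" 
    by (rule isCont_o2[of _ fst]) (use c1 in \<open>auto intro: continuous_intros\<close>)
  moreover have "isCont (\<lambda>p. chart_inv \<kappa> (snd p)) (e, e)"
    by (rule isCont_o2[of _ snd]) (use c1 in \<open>auto intro: continuous_intros\<close>)
  ultimately have c2: "isCont (\<lambda>p. (chart_inv \<kappa> (fst p), chart_inv \<kappa> (snd p))) (e, e)"
    by (rule continuous_Pair)
  have c3: "isCont (\<lambda>p. chart_inv \<kappa> (fst p) \<otimes> chart_inv \<kappa> (snd p)) (e, e)"
  proof -
    have "isCont (\<lambda>(g, h). g \<otimes> h) (chart_inv \<kappa> (fst (e, e)), chart_inv \<kappa> (snd (e, e)))"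
      using continuous_mult by (simp add: continuous_on_eq_continuous_at)
    from isCont_o2[OF c2 this] show ?thesis by simp
  qed
  have c4: "isCont ?m (e, e)"
    using isCont_o2[OF c3, of "snd \<kappa>"] isCont_chart[OF holomorphic_atlas id_chart] inv_e
    by (simp add: case_prod_beta')
  have m_e: "?m (e, e) = e" using inv_e by (simp add: e_def)
  \<comment> \<open>On this neighbourhood the coordinate expression of the product is meaningful and
    bounded. The radius 1 is arbitrary; it becomes the bound \<open>norm e + 1\<close> in
    \<open>mB\<close>.\<close>
  have ev: "\<forall>\<^sub>F p in nhds (e, e). fst p \<in> snd \<kappa> ` fst \<kappa> \<and> snd p \<in> snd \<kappa> ` fst \<kappa> \<and>
      chart_inv \<kappa> (fst p) \<otimes> chart_inv \<kappa> (snd p) \<in> fst \<kappa> \<and> ?m p \<in> ball e 1"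
  proof (intro eventually_conj)
    have e_in: "e \<in> snd \<kappa> ` fst \<kappa>" using id_chart(2) by (simp add: e_def)
    note op = atlas_open_image[OF holomorphic_atlas id_chart(1)]
    show "\<forall>\<^sub>F p in nhds (e, e). fst p \<in> snd \<kappa> ` fst \<kappa>" 
      using eventually_nhds_in_open[OF open_vimage_fst[OF op], of "(e, e)"] e_in by simp
    show "\<forall>\<^sub>F p in nhds (e, e). snd p \<in> snd \<kappa> ` fst \<kappa>"
      using eventually_nhds_in_open[OF open_vimage_snd[OF op], of "(e, e)"] e_in by simp
    show "\<forall>\<^sub>F p in nhds (e, e). chart_inv \<kappa> (fst p) \<otimes> chart_inv \<kappa> (snd p) \<in> fst \<kappa>"
      by (rule eventually_curve_in[OF c3 atlas_open_domain[OF holomorphic_atlas id_chart(1)]])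
         (use inv_e id_chart(2) in simp)
    show "\<forall>\<^sub>F p in nhds (e, e). ?m p \<in> ball e 1"
      by (rule eventually_curve_in[OF c4 open_ball]) (use m_e in simp)
  qed
  then obtain W where W: "open W" "(e, e) \<in> W" "\<And>p. p \<in> W \<Longrightarrow> fst p \<in> snd \<kappa> ` fst \<kappa> \<and> 
      snd p \<in> snd \<kappa> ` fst \<kappa> \<and> chart_inv \<kappa> (fst p) \<otimes> chart_inv \<kappa> (snd p) \<in> fst \<kappa> \<and> ?m p \<in> ball e 1"
    unfolding eventually_nhds by (elim exE conjE) (rule that, assumption+, erule (1) bspec)
  obtain B1 B2 where B: "open B1" "open B2" "e \<in> B1" "e \<in> B2" "B1 \<times> B2 \<subseteq> W"
    using open_prod_elim[OF W(1,2)] by (metis mem_Sigma_iff)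
  then have "open (B1 \<inter> B2)" "e \<in> B1 \<inter> B2" by auto
  then obtain \<rho> where \<rho>: "\<rho> > 0" "ball e \<rho> \<subseteq> B1 \<inter> B2" using openE by blast
  have inW: "(u, v) \<in> W" if "u \<in> ball e \<rho>" "v \<in> ball e \<rho>" for u v using that \<rho>(2) B(5) by blast
  \<comment> \<open>A derivative of the group law is chosen separately at each point; no regularity
    in \<open>p\<close> is asserted.\<close>
  define Q where "Q p L \<longleftrightarrow> (?m has_derivative L) (at p) \<and> (\<forall>a q r. L (a *s q, a *s r) = a *s L (q, r))" 
    for p and L :: "(complex^'n) \<times> (complex^'n) \<Rightarrow> complex^'n"
  define m' where "m' p = (SOME L. Q p L)" for p
  have Q: "Q (u, v) (m' (u, v))"
    if "u \<in> ball e \<rho>" "v \<in> ball e \<rho>" for u v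
  proof -
    let ?g = "chart_inv \<kappa> u" let ?h = "chart_inv \<kappa> v"
    have "?g \<in> fst \<kappa>" "snd \<kappa> ?g = u" "?h \<in> fst \<kappa>" "snd \<kappa> ?h = v" "?g \<otimes> ?h \<in> fst \<kappa>"
      using W(3)[OF inW[OF that]] chart by auto
    then have "(u, v) \<in> {(snd \<kappa> g, snd \<kappa> h) |g h. g \<in> fst \<kappa> \<and> h \<in> fst \<kappa> \<and> g \<otimes> h \<in> fst \<kappa>}" by force
    then have "\<exists>L. Q (u, v) L"
      using holomorphic_mult[OF id_chart(1) id_chart(1) id_chart(1)] 
      unfolding vec_holomorphic_on2_def Q_def by blast
    then show ?thesis unfolding m'_def by (rule someI_ex)
  qed
  have m': "(?m has_derivative m' (u, v)) (at (u, v)) \<and>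
      (\<forall>a p q. m' (u, v) (a *s p, a *s q) = a *s m' (u, v) (p, q))"
    if "u \<in> ball e \<rho>" "v \<in> ball e \<rho>" for u v using Q[OF that] unfolding Q_def .
  have mB: "norm (?m (u, v)) \<le> norm e + 1" if "u \<in> ball e \<rho>" "v \<in> ball e \<rho>" for u v
  proof -
    have "norm (?m (u, v) - e) < 1" 
      using W(3)[OF inW[OF that]] by (auto simp: dist_norm norm_minus_commute)
    then show ?thesis using norm_triangle_ineq2[of "?m (u, v)" e] by linarith
  qed
  obtain u r where r: "0 < r" "r \<le> R" "u z0 = e" and 
     u: "\<And>z. z \<in> ball z0 r \<Longrightarrow> u z \<in> ball e \<rho> \<and> has_cderiv u (m' (e, u z) (\<eta> z, 0)) z"
    by (rule group_law_initial_value_problem[OF \<rho>(1) assms(1) m' mB \<eta>]) (assumption+, rule that)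
  show thesis
  proof (rule that[OF r(1,2)])
    fix z assume z: "z \<in> ball z0 r"
    define g where "g = chart_inv \<kappa> (u z)"
    have "u z \<in> snd \<kappa> ` fst \<kappa>" using W(3)[OF inW, of e "u z"] u[OF z] \<rho>(1) by auto
    then have g: "g \<in> fst \<kappa>" "snd \<kappa> g = u z" using chart by (auto simp: g_def)
    let ?v = "m' (e, u z) (\<eta> z, 0)"
    have v1: "velocity \<kappa> (\<lambda>w. chart_inv \<kappa> (u w)) z ?v"
      using u[OF z] g by (intro velocity_chart_inv id_chart) force+
    \<comment> \<open>\<open>\<beta>\<close> is a test curve through the identity with the wanted
      velocity \<open>\<eta> z\<close>. By the differential equation the constructed curve and
      \<open>\<beta> w \<otimes> g\<close> have the same velocity at \<open>z\<close>, hence so have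
      their right translates by \<open>inv g\<close>, the second of which is
      \<open>\<beta>\<close>.\<close>
    obtain \<beta> where \<beta>: "velocity \<kappa> \<beta> z (\<eta> z)" "\<beta> z = \<one>" by (rule velocity_ex_at_one)
    have v2: "velocity \<kappa> (\<lambda>w. \<beta> w \<otimes> g) z ?v"
    proof -
      have "has_cderiv (\<lambda>w. ?m (snd \<kappa> (\<beta> w), u z)) ?v z"
        by (rule has_cderiv_compose2[of ?m _ "\<lambda>w. snd \<kappa> (\<beta> w)" z "\<lambda>_. u z"])
           (use m'[of e "u z"] u[OF z] \<rho>(1) \<beta> in \<open>auto simp: velocity_def has_cderiv_const simp flip: e_def\<close>)
      moreover have "\<forall>\<^sub>F w in nhds z. ?m (snd \<kappa> (\<beta> w), u z) = snd \<kappa> (\<beta> w \<otimes> g)"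
        using velocity_curve_chart[OF id_chart(1) \<beta>(1)] by eventually_elim (simp add: g_def)
      ultimately have "has_cderiv (\<lambda>w. snd \<kappa> (\<beta> w \<otimes> g)) ?v z"
        by (rule has_cderiv_transform)
      then show ?thesis using \<beta> g(1) isCont_mult[of z \<beta> "\<lambda>_. g"] by (simp add: velocity_def)
    qed
    obtain d where d: "d \<in> A" "inv g \<in> fst d" using atlas_cover[OF holomorphic_atlas] by metis
    have "g \<otimes> inv g \<in> fst \<kappa>" using id_chart(2) by simp
    then obtain L where L: 
      "\<And>\<gamma> \<delta> z u v. velocity \<kappa> \<gamma> z u \<Longrightarrow> velocity d \<delta> z v \<Longrightarrow> \<gamma> z = g \<Longrightarrow> \<delta> z = inv g \<Longrightarrow> 
         velocity \<kappa> (\<lambda>w. \<gamma> w \<otimes> \<delta> w) z (L (u, v))"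
      using velocity_mult[OF id_chart(1) d(1) id_chart(1) g(1) d(2)] by metis
    have 1: "velocity \<kappa> (\<lambda>w. chart_inv \<kappa> (u w) \<otimes> inv g) z (L (?v, 0))"
      by (rule L[OF v1 velocity_const[OF d(2)]]) (simp_all add: g_def)
    have "velocity \<kappa> (\<lambda>w. \<beta> w \<otimes> g \<otimes> inv g) z (L (?v, 0))"
      by (rule L[OF v2 velocity_const[OF d(2)]]) (simp_all add: \<beta>(2))
    then have "L (?v, 0) = \<eta> z" using \<beta>(1) velocity_unique by simp blast
    then show "velocity \<kappa> (\<lambda>w. chart_inv \<kappa> (u w) \<otimes> inv (chart_inv \<kappa> (u z))) z (\<eta> z)"
      using 1 by (simp add: g_def)
  qed
qed

end

section \<open>The equation on a Riemann surface\<close>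

lemma eventually_in_chart:
  assumes "atlas H S" "c \<in> S" "x \<in> fst c" "\<forall>\<^sub>F y in nhds x. P y"
  shows "\<forall>\<^sub>F z in nhds (snd c x). P (chart_inv c z)"
proof -
  obtain V where V: "open V" "x \<in> V" "\<forall>y\<in>V. P y" using assms(4) unfolding eventually_nhds by blast
  show ?thesis
    using eventually_chart_inv_in[OF assms(1-3) V(1,2)] by eventually_elim (use V(3) in blast)
qed

context complex_lie_group
begin

lemma isCont_of_velocity:
  fixes S :: "('a::t2_space, complex) chart set"
  assumes S: "atlas H S" "c \<in> S" "x \<in> fst c" and "velocity d (\<lambda>w. f (chart_inv c w)) (snd c x) v"
  shows "isCont f x"
proof -
  have "isCont (\<lambda>w. f (chart_inv c w)) (snd c x)" using assms(4) by (simp add: velocity_def)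
  from isCont_o2[OF isCont_chart[OF S] this] have "isCont (\<lambda>y. f (chart_inv c (snd c y))) x" .
  moreover have "\<forall>\<^sub>F y in nhds x. f (chart_inv c (snd c y)) = f y"
    using eventually_nhds_in_open[OF atlas_open_domain[OF S(1,2)] S(3)]
    by eventually_elim (simp add: chart_inv_chart[OF S(1,2)])
  ultimately show ?thesis 
    using isCont_cong[where f = "\<lambda>y. f (chart_inv c (snd c y))" and g = f and x = x] by blast
qed

lemma holomorphic_mapD:
  fixes S :: "('a::t2_space, complex) chart set"
  assumes S: "atlas H S" "c \<in> S" and "open U" and f: "holomorphic_map S A U f" 
    and x: "x \<in> U" "x \<in> fst c" and d: "d \<in> A" "f x \<in> fst d"
  shows "\<exists>v. velocity d (\<lambda>w. f (chart_inv c w)) (snd c x) v"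
proof -
  have cont: "continuous_on U f" using f by (simp add: holomorphic_map_def)
  define T where "T = snd c ` {x \<in> U \<inter> fst c. f x \<in> fst d}"
  have "open (U \<inter> f -` fst d)"
    by (rule continuous_open_preimage[OF cont \<open>open U\<close> atlas_open_domain[OF holomorphic_atlas d(1)]])
  then have "open (snd c ` ((U \<inter> f -` fst d) \<inter> fst c))" by (rule open_chart_image[OF S])
  moreover have "(U \<inter> f -` fst d) \<inter> fst c = {x \<in> U \<inter> fst c. f x \<in> fst d}" by blast
  ultimately have T: "open T" by (simp add: T_def)
  have xT: "snd c x \<in> T" using x d by (simp add: T_def)
  have "(\<lambda>z. snd d (f (chart_inv c z)) $ k) holomorphic_on T" for k
    using f S(2) d(1) by (simp add: holomorphic_map_def T_def)
  then have "((\<lambda>z. snd d (f (chart_inv c z)) $ k) has_field_derivative 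
      deriv (\<lambda>z. snd d (f (chart_inv c z)) $ k) (snd c x)) (at (snd c x))" for k
    using T xT by (rule holomorphic_derivI)
  then have "has_cderiv (\<lambda>z. snd d (f (chart_inv c z))) 
      (\<chi> k. deriv (\<lambda>z. snd d (f (chart_inv c z)) $ k) (snd c x)) (snd c x)"
    by (simp add: has_cderiv_iff)
  moreover have "isCont (\<lambda>w. f (chart_inv c w)) (snd c x)"
  proof (rule isCont_o2[OF isCont_chart_inv[OF S x(2)]])
    show "isCont f (chart_inv c (snd c x))"
      using cont x \<open>open U\<close> by (simp add: chart_inv_chart[OF S] continuous_on_eq_continuous_at)
  qed
  ultimately show ?thesis using x d chart_inv_chart[OF S x(2)] unfolding velocity_def by auto
qed

text \<open>A velocity at each point carries continuity as well as differentiability, so both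
  clauses of \<open>holomorphic_map\<close> follow from one pointwise condition.\<close>

lemma holomorphic_mapI:
  fixes S :: "('a::t2_space, complex) chart set"
  assumes S: "atlas H S" and "open U"
    and f: "\<And>c d x. c \<in> S \<Longrightarrow> x \<in> U \<Longrightarrow> x \<in> fst c \<Longrightarrow> d \<in> A \<Longrightarrow> f x \<in> fst d \<Longrightarrow>
      \<exists>v. velocity d (\<lambda>w. f (chart_inv c w)) (snd c x) v"
  shows "holomorphic_map S A U f"
  unfolding holomorphic_map_def
proof (intro conjI ballI allI)
  have "isCont f x" if x: "x \<in> U" for x
  proof -
    obtain c where c: "c \<in> S" "x \<in> fst c" using atlas_cover[OF S] by metis
    obtain d where d: "d \<in> A" "f x \<in> fst d" using atlas_cover[OF holomorphic_atlas] by metis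
    from f[OF c(1) x c(2) d] obtain v where "velocity d (\<lambda>w. f (chart_inv c w)) (snd c x) v" ..
    then show ?thesis by (rule isCont_of_velocity[OF S c])
  qed
  then show "continuous_on U f" by (simp add: continuous_at_imp_continuous_on)
  fix c d and k :: 'n assume c: "c \<in> S" and d: "d \<in> A"
  show "(\<lambda>z. snd d (f (chart_inv c z)) $ k) holomorphic_on snd c ` {x \<in> U \<inter> fst c. f x \<in> fst d}"
  proof (rule has_cderiv_imp_holomorphic)
    fix z assume "z \<in> snd c ` {x \<in> U \<inter> fst c. f x \<in> fst d}"
    then obtain x where x: "z = snd c x" "x \<in> U" "x \<in> fst c" "f x \<in> fst d" by blast
    show "\<exists>v. has_cderiv (\<lambda>z. snd d (f (chart_inv c z))) v z"
      using f[OF c x(2,3) d x(4)] unfolding x(1) velocity_def by blast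
  qed
qed

lemma holomorphic_map_mult:
  fixes S :: "('a::t2_space, complex) chart set"
  assumes S: "atlas H S" and "open U" "holomorphic_map S A U f" "holomorphic_map S A U g"
  shows "holomorphic_map S A U (\<lambda>x. f x \<otimes> g x)"
proof (rule holomorphic_mapI[OF S \<open>open U\<close>])
  fix c d x assume c: "c \<in> S" and x: "x \<in> U" "x \<in> fst c" and d: "d \<in> A" "f x \<otimes> g x \<in> fst d"
  obtain d1 where d1: "d1 \<in> A" "f x \<in> fst d1" using atlas_cover[OF holomorphic_atlas] by metis
  obtain d2 where d2: "d2 \<in> A" "g x \<in> fst d2" using atlas_cover[OF holomorphic_atlas] by metis
  obtain u where u: "velocity d1 (\<lambda>w. f (chart_inv c w)) (snd c x) u"
    using holomorphic_mapD[OF S c \<open>open U\<close> assms(3) x d1] ..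
  obtain v where v: "velocity d2 (\<lambda>w. g (chart_inv c w)) (snd c x) v"
    using holomorphic_mapD[OF S c \<open>open U\<close> assms(4) x d2] ..
  show "\<exists>v. velocity d (\<lambda>w. f (chart_inv c w) \<otimes> g (chart_inv c w)) (snd c x) v"
    by (rule velocity_mult_ex[OF d1(1) d2(1) d(1) u v]) (simp add: chart_inv_chart[OF S c x(2)] d(2))
qed

lemma holomorphic_map_inverse:
  fixes S :: "('a::t2_space, complex) chart set"
  assumes S: "atlas H S" and "open U" "holomorphic_map S A U f"
  shows "holomorphic_map S A U (\<lambda>x. inv (f x))"
proof (rule holomorphic_mapI[OF S \<open>open U\<close>])
  fix c d x assume c: "c \<in> S" and x: "x \<in> U" "x \<in> fst c" and d: "d \<in> A" "inv (f x) \<in> fst d"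
  obtain d1 where d1: "d1 \<in> A" "f x \<in> fst d1" using atlas_cover[OF holomorphic_atlas] by metis
  obtain u where u: "velocity d1 (\<lambda>w. f (chart_inv c w)) (snd c x) u"
    using holomorphic_mapD[OF S c \<open>open U\<close> assms(3) x d1] ..
  show "\<exists>v. velocity d (\<lambda>w. inv (f (chart_inv c w))) (snd c x) v"
    by (rule velocity_inverse_ex[OF d1(1) d(1) u]) (simp add: chart_inv_chart[OF S c x(2)] d(2))
qed

lemma holomorphic_map_const: 
  fixes S :: "('a::t2_space, complex) chart set"
  shows "atlas H S \<Longrightarrow> open U \<Longrightarrow> holomorphic_map S A U (\<lambda>_. g)"
  by (rule holomorphic_mapI) (auto intro: velocity_const)

lemma holomorphic_map_subset:
  fixes S :: "('a::t2_space, complex) chart set"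
  assumes S: "atlas H S" and "open U" "open V" "V \<subseteq> U" "holomorphic_map S A U f"
  shows "holomorphic_map S A V f"
  by (rule holomorphic_mapI[OF S \<open>open V\<close>]) (use holomorphic_mapD[OF S _ \<open>open U\<close> assms(5)] \<open>V \<subseteq> U\<close> in blast)

text \<open>\<open>right_log_deriv\<close> is built from \<open>deriv\<close>, which has a value
  even where no derivative exists; the right-hand side includes existence. Conversely, right
  translation by \<open>\<psi> x\<close> turns the velocity of
  \<open>\<psi> \<psi>(x)\<inverse>\<close> into one of \<open>\<psi>\<close>, so the pointwise
  condition already contains holomorphy.\<close>

lemma is_solution_iff:
  fixes S :: "('a::t2_space, complex) chart set"
  assumes S: "atlas H S" and "open U"
  shows "is_solution G A S lam \<xi> U \<psi> \<longleftrightarrow> (\<forall>c\<in>S. \<forall>x\<in>U \<inter> fst c. 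
    \<exists>v. velocity \<kappa> (\<lambda>w. \<psi> (chart_inv c w) \<otimes> inv (\<psi> x)) (snd c x) v \<and> lam *s v + \<xi> c x = 0)"
    (is "?L \<longleftrightarrow> ?R")
proof
  assume L: ?L
  show ?R
  proof (intro ballI)
    fix c x assume c: "c \<in> S" and x: "x \<in> U \<inter> fst c"
    have "holomorphic_map S A U (\<lambda>y. \<psi> y \<otimes> inv (\<psi> x))"
      using L by (intro holomorphic_map_mult[OF S \<open>open U\<close>] holomorphic_map_const[OF S \<open>open U\<close>]) 
        (simp add: is_solution_def)
    from holomorphic_mapD[OF S c \<open>open U\<close> this _ _ id_chart(1), of x] x id_chart(2)
    obtain v where v: "velocity \<kappa> (\<lambda>w. \<psi> (chart_inv c w) \<otimes> inv (\<psi> x)) (snd c x) v" by auto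
    then have "right_log_deriv G A \<psi> c x = v"
      unfolding velocity_def right_log_deriv_def has_cderiv_iff
      by (simp add: vec_eq_iff DERIV_imp_deriv)
    moreover have "lam *s right_log_deriv G A \<psi> c x + \<xi> c x = 0"
      using L c x by (simp add: is_solution_def)
    ultimately show "\<exists>v. velocity \<kappa> (\<lambda>w. \<psi> (chart_inv c w) \<otimes> inv (\<psi> x)) (snd c x) v \<and> lam *s v + \<xi> c x = 0"
      using v by auto
  qed
next
  assume R: ?R
  show ?L
    unfolding is_solution_def
  proof (intro conjI ballI)
    show "holomorphic_map S A U \<psi>"
    proof (rule holomorphic_mapI[OF S \<open>open U\<close>])
      fix c d x assume c: "c \<in> S" and x: "x \<in> U" "x \<in> fst c" and d: "d \<in> A" "\<psi> x \<in> fst d"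
      obtain v where v: "velocity \<kappa> (\<lambda>w. \<psi> (chart_inv c w) \<otimes> inv (\<psi> x)) (snd c x) v" 
        using R c x by blast
      have "\<exists>v. velocity d (\<lambda>w. \<psi> (chart_inv c w) \<otimes> inv (\<psi> x) \<otimes> \<psi> x) (snd c x) v"
        by (rule velocity_mult_ex[OF id_chart(1) d(1) d(1) v velocity_const[OF d(2)]])
           (simp add: chart_inv_chart[OF S c x(2)] d(2))
      then show "\<exists>v. velocity d (\<lambda>w. \<psi> (chart_inv c w)) (snd c x) v" by simp
    qed
    fix c x assume c: "c \<in> S" and x: "x \<in> U \<inter> fst c"
    obtain v where v: "velocity \<kappa> (\<lambda>w. \<psi> (chart_inv c w) \<otimes> inv (\<psi> x)) (snd c x) v" 
      "lam *s v + \<xi> c x = 0" using R c x by blast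
    then have "right_log_deriv G A \<psi> c x = v"
      unfolding velocity_def right_log_deriv_def has_cderiv_iff
      by (simp add: vec_eq_iff DERIV_imp_deriv)
    then show "lam *s right_log_deriv G A \<psi> c x + \<xi> c x = 0" using v(2) by simp
  qed
qed

text \<open>Velocities depend only on the germ of a curve, so a function that is locally a solution
  is a solution. This converts the glued section into a solution.\<close>

lemma is_solution_local:
  fixes S :: "('a::t2_space, complex) chart set"
  assumes S: "atlas H S" and "open U"
    and loc: "\<And>x. x \<in> U \<Longrightarrow> \<exists>V \<psi> N. open V \<and> is_solution G A S lam \<xi> V \<psi> \<and> open N \<and> x \<in> N \<and> 
      N \<inter> U \<subseteq> V \<and> (\<forall>y\<in>N \<inter> U. f y = \<psi> y)"
  shows "is_solution G A S lam \<xi> U f"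
  unfolding is_solution_iff[OF S \<open>open U\<close>]
proof (intro ballI)
  fix c x assume c: "c \<in> S" and x: "x \<in> U \<inter> fst c"
  then have "x \<in> U" by blast
  from loc[OF this] obtain V \<psi> N where V: "open V" "is_solution G A S lam \<xi> V \<psi>" "open N" "x \<in> N"
    "N \<inter> U \<subseteq> V" "\<forall>y\<in>N \<inter> U. f y = \<psi> y" by (elim exE conjE) (rule that)
  have "x \<in> V \<inter> fst c" using V(4,5) x by blast
  then obtain v where v: "velocity \<kappa> (\<lambda>w. \<psi> (chart_inv c w) \<otimes> inv (\<psi> x)) (snd c x) v" 
    "lam *s v + \<xi> c x = 0" using V(2) c unfolding is_solution_iff[OF S V(1)] by blast
  have fx: "f x = \<psi> x" using V(4,6) x by blast
  have "\<forall>\<^sub>F w in nhds (snd c x). f (chart_inv c w) \<otimes> inv (f x) = \<psi> (chart_inv c w) \<otimes> inv (\<psi> x)"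
  proof -
    have "\<forall>\<^sub>F y in nhds x. y \<in> N \<inter> U"
      using V(3,4) \<open>open U\<close> x by (intro eventually_nhds_in_open) auto
    then have "\<forall>\<^sub>F w in nhds (snd c x). chart_inv c w \<in> N \<inter> U"
      by (intro eventually_in_chart[OF S c]) (use x in blast)
    then show ?thesis by eventually_elim (use V(6) fx in simp)
  qed
  from velocity_cong[OF this] v(1) have "velocity \<kappa> (\<lambda>w. f (chart_inv c w) \<otimes> inv (f x)) (snd c x) v"
    by blast
  then show "\<exists>v. velocity \<kappa> (\<lambda>w. f (chart_inv c w) \<otimes> inv (f x)) (snd c x) v \<and> lam *s v + \<xi> c x = 0"
    using v(2) by blast
qed

text \<open>The constant cancels in \<open>(\<psi> g)(\<psi> g)\<inverse>\<close>. This symmetry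
  provides solutions with any prescribed value at a point.\<close>

lemma is_solution_right_translate:
  fixes S :: "('a::t2_space, complex) chart set"
  assumes S: "atlas H S" and "open U" "is_solution G A S lam \<xi> U \<psi>"
  shows "is_solution G A S lam \<xi> U (\<lambda>x. \<psi> x \<otimes> g)"
proof -
  have "\<psi> y \<otimes> g \<otimes> inv (\<psi> x \<otimes> g) = \<psi> y \<otimes> inv (\<psi> x)" for x y
    by (simp add: inv_mult_group flip: m_assoc)
  then show ?thesis using assms(3) unfolding is_solution_iff[OF S \<open>open U\<close>] by simp
qed

text \<open>With \<open>a\<^sub>i = \<psi>\<^sub>i \<psi>\<^sub>i(y)\<inverse>\<close> and \<open>b = a\<^sub>1\<inverse>a\<^sub>2\<close>, differentiating \<open>a\<^sub>1b = a\<^sub>2\<close> at \<open>y\<close>, where all three are the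
  identity, shows that \<open>b\<close> has velocity zero; and \<open>\<psi>\<^sub>1\<inverse>\<psi>\<^sub>2 = \<psi>\<^sub>1(y)\<inverse> b \<psi>\<^sub>2(y)\<close>.\<close>

lemma solution_quotient_velocity:
  fixes S :: "('a::t2_space, complex) chart set"
  assumes S: "atlas H S" and "open V" "open W" "lam \<noteq> 0" 
    and \<psi>1: "is_solution G A S lam \<xi> V \<psi>1" and \<psi>2: "is_solution G A S lam \<xi> W \<psi>2"
    and c: "c \<in> S" and y: "y \<in> V \<inter> W" "y \<in> fst c" and d: "d \<in> A" "inv (\<psi>1 y) \<otimes> \<psi>2 y \<in> fst d"
  shows "velocity d (\<lambda>w. inv (\<psi>1 (chart_inv c w)) \<otimes> \<psi>2 (chart_inv c w)) (snd c y) 0"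
proof -
  let ?z = "snd c y"
  let ?a1 = "\<lambda>w. \<psi>1 (chart_inv c w) \<otimes> inv (\<psi>1 y)"
  let ?a2 = "\<lambda>w. \<psi>2 (chart_inv c w) \<otimes> inv (\<psi>2 y)"
  let ?b = "\<lambda>w. inv (?a1 w) \<otimes> ?a2 w"
  have cy: "chart_inv c ?z = y" by (rule chart_inv_chart[OF S c y(2)])
  obtain v where v: "velocity \<kappa> ?a1 ?z v" "lam *s v + \<xi> c y = 0"
    using \<psi>1 c y unfolding is_solution_iff[OF S \<open>open V\<close>] by blast
  obtain v' where v': "velocity \<kappa> ?a2 ?z v'" "lam *s v' + \<xi> c y = 0"
    using \<psi>2 c y unfolding is_solution_iff[OF S \<open>open W\<close>] by blast
  have "lam *s v' = lam *s v" using v(2) v'(2) by (metis add_right_cancel)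
  \<comment> \<open>Division by \<open>lam\<close> is what lets \<open>\<xi>\<close> determine the
    velocity; for \<open>lam = 0\<close> two solutions could have unrelated velocities.\<close>
  then have "v' = v" using \<open>lam \<noteq> 0\<close> by simp
  have "\<exists>u. velocity \<kappa> (\<lambda>w. inv (?a1 w)) ?z u"
    by (rule velocity_inverse_ex[OF id_chart(1) id_chart(1) v(1)]) (simp add: cy id_chart(2))
  then obtain u where u: "velocity \<kappa> (\<lambda>w. inv (?a1 w)) ?z u" ..
  have "\<exists>\<beta>. velocity \<kappa> ?b ?z \<beta>"
    by (rule velocity_mult_ex[OF id_chart(1) id_chart(1) id_chart(1) u v'(1)]) (simp add: cy id_chart(2))
  then obtain \<beta> where \<beta>: "velocity \<kappa> ?b ?z \<beta>" ..
  have "velocity \<kappa> (\<lambda>w. ?a1 w \<otimes> ?b w) ?z (v + \<beta>)"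
    by (rule velocity_mult_one[OF v(1) \<beta>]) (simp_all add: cy)
  moreover have "?a1 w \<otimes> ?b w = ?a2 w" for w by (simp flip: m_assoc)
  ultimately have "velocity \<kappa> ?a2 ?z (v + \<beta>)" by simp
  then have "v + \<beta> = v" using v'(1) \<open>v' = v\<close> velocity_unique by blast
  then have \<beta>0: "velocity \<kappa> ?b ?z 0" using \<beta> by simp
  obtain d2 where d2: "d2 \<in> A" "\<psi>2 y \<in> fst d2" using atlas_cover[OF holomorphic_atlas] by metis
  have 1: "velocity d2 (\<lambda>w. ?b w \<otimes> \<psi>2 y) ?z 0"
    by (rule velocity_zero_mult_const(1)[OF id_chart(1) d2(1) \<beta>0]) (simp add: cy d2(2))
  have "velocity d (\<lambda>w. inv (\<psi>1 y) \<otimes> (?b w \<otimes> \<psi>2 y)) ?z 0"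
    by (rule velocity_zero_mult_const(2)[OF d2(1) d(1) 1]) (simp add: cy d(2))
  moreover have "inv (\<psi>1 y) \<otimes> (?b w \<otimes> \<psi>2 y) = inv (\<psi>1 (chart_inv c w)) \<otimes> \<psi>2 (chart_inv c w)" for w
    by (simp add: inv_mult_group flip: m_assoc)
  ultimately show ?thesis by simp
qed

text \<open>In coordinates the quotient has zero derivative on a disc, hence is constant there, and
  injectivity of the group chart carries this back to the group.\<close>

lemma solution_quotient_locally_constant:
  fixes S :: "('a::t2_space, complex) chart set"
  assumes S: "atlas H S" and "open V" "open W" "lam \<noteq> 0" 
    and \<psi>1: "is_solution G A S lam \<xi> V \<psi>1" and \<psi>2: "is_solution G A S lam \<xi> W \<psi>2"
    and x: "x \<in> V \<inter> W"
  shows "\<exists>N. open N \<and> x \<in> N \<and> N \<subseteq> V \<inter> W \<and> (\<forall>y\<in>N. inv (\<psi>1 y) \<otimes> \<psi>2 y = inv (\<psi>1 x) \<otimes> \<psi>2 x)"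
proof -
  define \<phi> where "\<phi> y = inv (\<psi>1 y) \<otimes> \<psi>2 y" for y
  obtain c where c: "c \<in> S" "x \<in> fst c" using atlas_cover[OF S] by metis
  obtain d where d: "d \<in> A" "\<phi> x \<in> fst d" using atlas_cover[OF holomorphic_atlas] by metis
  have VW: "open (V \<inter> W)" using assms by blast
  have "holomorphic_map S A (V \<inter> W) \<phi>"
    unfolding \<phi>_def
  proof (intro holomorphic_map_mult[OF S VW] holomorphic_map_inverse[OF S VW])
    show "holomorphic_map S A (V \<inter> W) \<psi>1"
      using \<psi>1 by (intro holomorphic_map_subset[OF S \<open>open V\<close> VW]) (auto simp: is_solution_def)
    show "holomorphic_map S A (V \<inter> W) \<psi>2"
      using \<psi>2 by (intro holomorphic_map_subset[OF S \<open>open W\<close> VW]) (auto simp: is_solution_def)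
  qed
  then have "continuous_on (V \<inter> W) \<phi>" by (simp add: holomorphic_map_def)
  then have O: "open (V \<inter> W \<inter> \<phi> -` fst d)"
    using continuous_open_preimage VW atlas_open_domain[OF holomorphic_atlas d(1)] by blast
  then have "open (snd c ` (V \<inter> W \<inter> \<phi> -` fst d \<inter> fst c))" by (rule open_chart_image[OF S c(1)])
  moreover have "snd c x \<in> snd c ` (V \<inter> W \<inter> \<phi> -` fst d \<inter> fst c)" using x c d by blast
  \<comment> \<open>The disc is small enough for the quotient to stay in one chart \<open>d\<close>
    of the group.\<close>
  ultimately obtain r where r: "r > 0" "ball (snd c x) r \<subseteq> snd c ` (V \<inter> W \<inter> \<phi> -` fst d \<inter> fst c)"
    using openE by blast
  have vel: "has_cderiv (\<lambda>w. snd d (\<phi> (chart_inv c w))) 0 z" if z: "z \<in> ball (snd c x) r" for z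
  proof -
    obtain y where y: "z = snd c y" "y \<in> V \<inter> W" "\<phi> y \<in> fst d" "y \<in> fst c" using r(2) z by blast
    show ?thesis
      using solution_quotient_velocity[OF S assms(2-4) \<psi>1 \<psi>2 c(1) y(2,4) d(1)] y(3)
      by (simp add: y(1) \<phi>_def velocity_def)
  qed
  have const: "\<phi> y = \<phi> x" if y: "y \<in> fst c" "snd c y \<in> ball (snd c x) r" for y
  proof -
    have cy: "chart_inv c (snd c y) = y" "chart_inv c (snd c x) = x"
      using chart_inv_chart[OF S c(1)] y(1) c(2) by auto
    have "norm (snd d (\<phi> (chart_inv c (snd c y))) - snd d (\<phi> (chart_inv c (snd c x)))) \<le> 
        0 * norm (snd c y - snd c x)"
      by (rule has_cderiv_lipschitz[where f' = "\<lambda>_. 0", OF vel]) (use y r in auto)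
    then have eq: "snd d (\<phi> y) = snd d (\<phi> x)" by (simp add: cy)
    obtain y' where "snd c y = snd c y'" "\<phi> y' \<in> fst d" "y' \<in> fst c" using r(2) y(2) by blast
    then have "\<phi> y \<in> fst d" using chart_inv_chart[OF S c(1)] y(1) by metis
    then show ?thesis using eq d chart_inv_chart[OF holomorphic_atlas d(1)] by metis
  qed
  show ?thesis
  proof (intro exI[of _ "V \<inter> W \<inter> (fst c \<inter> snd c -` ball (snd c x) r)"] conjI ballI)
    show "open (V \<inter> W \<inter> (fst c \<inter> snd c -` ball (snd c x) r))"
      using VW open_chart_preimage[OF S c(1) open_ball] by blast
    show "x \<in> V \<inter> W \<inter> (fst c \<inter> snd c -` ball (snd c x) r)" using x c r(1) by simp
    fix y assume "y \<in> V \<inter> W \<inter> (fst c \<inter> snd c -` ball (snd c x) r)"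
    then show "inv (\<psi>1 y) \<otimes> \<psi>2 y = inv (\<psi>1 x) \<otimes> \<psi>2 x" using const[of y] by (simp add: \<phi>_def)
  qed blast
qed

text \<open>The equation is solved in one chart \<open>c\<close> around \<open>x\<close>. In any
  other chart the velocity and the coefficient of \<open>\<xi>\<close> are both multiplied by the
  derivative of the coordinate change, so the equation persists.\<close>

lemma local_solution_ex:
  fixes S :: "('a::t2_space, complex) chart set"
  assumes S: "riemann_surface S" and \<xi>: "\<xi> \<in> holomorphic_one_forms S M" 
    and "lam \<noteq> 0" "open U" "U \<subseteq> M" "x \<in> U"
  shows "\<exists>V \<psi>. open V \<and> x \<in> V \<and> V \<subseteq> U \<and> is_solution G A S lam \<xi> V \<psi>"
proof -
  note at = riemann_surface.holomorphic_atlas[OF S]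
  obtain c where c: "c \<in> S" "x \<in> fst c" using atlas_cover[OF at] by metis
  have "open (snd c ` (U \<inter> fst c))" by (rule open_chart_image[OF at c(1) \<open>open U\<close>])
  moreover have "snd c x \<in> snd c ` (U \<inter> fst c)" using c \<open>x \<in> U\<close> by blast
  ultimately obtain R where R: "R > 0" "ball (snd c x) R \<subseteq> snd c ` (U \<inter> fst c)"
    using openE by blast
  \<comment> \<open>The velocity obtained by solving the equation in the coordinate of
    \<open>c\<close>.\<close>
  define \<eta> where "\<eta> z = (- 1 / lam) *s \<xi> c (chart_inv c z)" for z
  have "(\<lambda>z. \<xi> c (chart_inv c z) $ k) holomorphic_on snd c ` (M \<inter> fst c)" for k
    using \<xi> c(1) by (simp add: holomorphic_one_forms_def)
  then have "(\<lambda>z. \<xi> c (chart_inv c z) $ k) holomorphic_on ball (snd c x) R" for k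
    by (rule holomorphic_on_subset) (use R(2) \<open>U \<subseteq> M\<close> in blast)
  then have "(\<lambda>z. \<eta> z $ k) holomorphic_on ball (snd c x) R" for k
    unfolding \<eta>_def by (auto intro!: holomorphic_intros)
  from local_curve_ex[OF R(1) this] obtain \<gamma> r where r: "r > 0" "r \<le> R" and 
    \<gamma>: "\<And>z. z \<in> ball (snd c x) r \<Longrightarrow> velocity \<kappa> (\<lambda>w. \<gamma> w \<otimes> inv (\<gamma> z)) z (\<eta> z)" by metis
  define V where "V = U \<inter> (fst c \<inter> snd c -` ball (snd c x) r)"
  have V: "open V" "x \<in> V" "V \<subseteq> U"
    using \<open>open U\<close> open_chart_preimage[OF at c(1) open_ball] \<open>x \<in> U\<close> c r(1) by (auto simp: V_def)
  define \<psi> where "\<psi> y = \<gamma> (snd c y)" for y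
  have "is_solution G A S lam \<xi> V \<psi>"
    unfolding is_solution_iff[OF at V(1)]
  proof (intro ballI)
    fix c' y assume c': "c' \<in> S" and y: "y \<in> V \<inter> fst c'"
    let ?\<tau> = "snd c \<circ> chart_inv c'" and ?z = "snd c y"
    have yc: "y \<in> fst c" "?z \<in> ball (snd c x) r" "y \<in> M" using y \<open>U \<subseteq> M\<close> by (auto simp: V_def)
    have cy: "chart_inv c ?z = y" "chart_inv c' (snd c' y) = y" 
      using chart_inv_chart[OF at c(1) yc(1)] chart_inv_chart[OF at c'] y by auto
    define a where "a = deriv ?\<tau> (snd c' y)"
    have "?\<tau> holomorphic_on snd c' ` (fst c' \<inter> fst c)" by (rule atlas_transition[OF at c' c(1)])
    moreover have "open (snd c' ` (fst c' \<inter> fst c))"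
      using open_chart_image[OF at c' atlas_open_domain[OF at c(1)]] by (simp add: Int_commute)
    ultimately have "(?\<tau> has_field_derivative a) (at (snd c' y))"
      unfolding a_def by (rule holomorphic_derivI) (use y yc in blast)
    then have 1: "velocity \<kappa> (\<lambda>w. \<gamma> (?\<tau> w) \<otimes> inv (\<gamma> ?z)) (snd c' y) (a *s \<eta> ?z)"
      by (intro velocity_reparametrise[where \<gamma> = "\<lambda>w. \<gamma> w \<otimes> inv (\<gamma> ?z)"]) (simp_all add: cy \<gamma>[OF yc(2)] o_def)
    have "\<xi> c' y = a *s \<xi> c y"
      using \<xi> c' c(1) y yc unfolding holomorphic_one_forms_def a_def by blast
    then have "lam *s (a *s \<eta> ?z) + \<xi> c' y = 0"
      using \<open>lam \<noteq> 0\<close> by (simp add: \<eta>_def cy vec_eq_iff)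
    then show "\<exists>v. velocity \<kappa> (\<lambda>w. \<psi> (chart_inv c' w) \<otimes> inv (\<psi> y)) (snd c' y) v \<and> lam *s v + \<xi> c' y = 0"
      using 1 by (intro exI[of _ "a *s \<eta> ?z"]) (simp add: \<psi>_def)
  qed
  then show ?thesis using V by blast
qed

lemma solution_ex_contractible:
  fixes S :: "('a::t2_space, complex) chart set"
  assumes S: "riemann_surface S" and \<xi>: "\<xi> \<in> holomorphic_one_forms S M" 
    and "lam \<noteq> 0" "open U" "U \<subseteq> M" "contractible U"
  shows "\<exists>\<psi>. is_solution G A S lam \<xi> U \<psi>"
proof -
  note at = riemann_surface.holomorphic_atlas[OF S]
  define Sol where "Sol V \<psi> \<longleftrightarrow> open V \<and> is_solution G A S lam \<xi> V \<psi>" for V \<psi>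
  have ext: "\<exists>V. open V \<and> x \<in> V \<and> (\<forall>y\<in>V. \<forall>g. \<exists>\<psi>. Sol V \<psi> \<and> \<psi> y = g)" if x: "x \<in> U" for x
  proof -
    obtain V \<psi> where V: "open V" "x \<in> V" "is_solution G A S lam \<xi> V \<psi>"
      using local_solution_ex[OF S \<xi> assms(3-5) x] by blast
    have "\<exists>\<psi>'. Sol V \<psi>' \<and> \<psi>' y = g" for y g
    \<comment> \<open>Right translation by \<open>inv (\<psi> y) \<otimes> g\<close> adjusts the
      value at \<open>y\<close> to \<open>g\<close> without changing the domain, so one
      \<open>V\<close> serves all \<open>y\<close> and \<open>g\<close>.\<close>
    proof (intro exI[of _ "\<lambda>w. \<psi> w \<otimes> (inv (\<psi> y) \<otimes> g)"] conjI)
      show "Sol V (\<lambda>w. \<psi> w \<otimes> (inv (\<psi> y) \<otimes> g))"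
        unfolding Sol_def using V is_solution_right_translate[OF at V(1,3)] by blast
      show "\<psi> y \<otimes> (inv (\<psi> y) \<otimes> g) = g" by (simp flip: m_assoc)
    qed
    then show ?thesis using V by blast
  qed
  have uniq: "\<exists>N. open N \<and> x \<in> N \<and> N \<subseteq> V \<inter> W \<and> (\<forall>y\<in>N. \<psi> y = \<psi>' y \<longleftrightarrow> \<psi> x = \<psi>' x)"
    if "Sol V \<psi>" "Sol W \<psi>'" "x \<in> V \<inter> W" for V W \<psi> \<psi>' x
  proof -
    have "\<exists>N. open N \<and> x \<in> N \<and> N \<subseteq> V \<inter> W \<and> (\<forall>y\<in>N. inv (\<psi> y) \<otimes> \<psi>' y = inv (\<psi> x) \<otimes> \<psi>' x)"
      using that unfolding Sol_def 
      by (intro solution_quotient_locally_constant[OF at _ _ assms(3)]) auto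
    then obtain N where N: "open N" "x \<in> N" "N \<subseteq> V \<inter> W" 
      "\<forall>y\<in>N. inv (\<psi> y) \<otimes> \<psi>' y = inv (\<psi> x) \<otimes> \<psi>' x" by (elim exE conjE) (rule that)
    \<comment> \<open>Two solutions agree where their quotient is the identity; a locally constant
      quotient thus makes agreement and disagreement both propagate.\<close>
    have iff: "\<psi> y = \<psi>' y \<longleftrightarrow> inv (\<psi> y) \<otimes> \<psi>' y = \<one>" for y
      by (metis in_carrier inv_equality inv_inv l_inv)
    have "\<psi> y = \<psi>' y \<longleftrightarrow> \<psi> x = \<psi>' x" if "y \<in> N" for y
      unfolding iff[of y] iff[of x] bspec[OF N(4) that] ..
    then show ?thesis using N(1-3) by blast
  qed
  obtain f where f: "\<And>x. x \<in> U \<Longrightarrow> 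
      \<exists>V \<psi> N. Sol V \<psi> \<and> open N \<and> x \<in> N \<and> N \<inter> U \<subseteq> V \<and> (\<forall>y\<in>N \<inter> U. f y = \<psi> y)"
    by (rule global_section_contractible[OF assms(6), of Sol, OF ext uniq]) (assumption+, rule that)
  have "is_solution G A S lam \<xi> U f"
    by (rule is_solution_local[OF at \<open>open U\<close> f[unfolded Sol_def conj_assoc]])
  then show ?thesis by blast
qed

end

section \<open>The bundle of a family of solutions\<close>

lemma contractible_imp_connected_set: 
  fixes S :: "'a::topological_space set"
  assumes "contractible S"
  shows "connected S"
  using contractible_imp_connected_space[of "top_of_set S"] assms 
  unfolding connectedin_iff_connected[symmetric] connectedin_def by simp

context complex_lie_group
begin

text \<open>The cocycle identity is the cancellation of
  \<open>\<psi>\<^sub>j \<psi>\<^sub>j\<inverse>\<close>. This covers \<open>lam = 0\<close> as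
  well, where the quotients may vary from point to point.\<close>

lemma holomorphic_cocycle_quotients:
  fixes S :: "('a::t2_space, complex) chart set"
  assumes S: "atlas H S" and U: "\<And>i. i \<in> I \<Longrightarrow> open (U i)" 
    and \<psi>: "\<And>i. i \<in> I \<Longrightarrow> holomorphic_map S A (U i) (\<psi> i)"
  shows "holomorphic_cocycle G A S I U (\<lambda>i j x. inv (\<psi> i x) \<otimes> \<psi> j x)"
  unfolding holomorphic_cocycle_def
proof (intro conjI ballI)
  fix i j assume i: "i \<in> I" and j: "j \<in> I"
  have Uij: "open (U i \<inter> U j)" using U i j by blast
  show "holomorphic_map S A (U i \<inter> U j) (\<lambda>x. inv (\<psi> i x) \<otimes> \<psi> j x)"
  proof (intro holomorphic_map_mult[OF S Uij] holomorphic_map_inverse[OF S Uij])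
    show "holomorphic_map S A (U i \<inter> U j) (\<psi> i)"
      by (rule holomorphic_map_subset[OF S U[OF i] Uij _ \<psi>[OF i]]) blast
    show "holomorphic_map S A (U i \<inter> U j) (\<psi> j)"
      by (rule holomorphic_map_subset[OF S U[OF j] Uij _ \<psi>[OF j]]) blast
  qed
next
  fix i j k x
  have "\<psi> j x \<otimes> (inv (\<psi> j x) \<otimes> \<psi> k x) = \<psi> k x" by (simp flip: m_assoc)
  then show "inv (\<psi> i x) \<otimes> \<psi> j x \<otimes> (inv (\<psi> j x) \<otimes> \<psi> k x) = inv (\<psi> i x) \<otimes> \<psi> k x" 
    by (simp add: m_assoc)
qed simp

text \<open>The bundle with transition functions \<open>\<psi>\<^sub>i\<inverse>\<psi>\<^sub>j\<close> is realised on \<open>M \<times> G\<close> with the trivialisations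
  \<open>(x, g) \<mapsto> \<psi>\<^sub>i(x)\<inverse> g\<close>.\<close>

lemma principal_bundle_of_quotients:
  fixes S :: "('a::t2_space, complex) chart set" and U :: "'i \<Rightarrow> 'a set" and I :: "'i set" 
    and \<psi> :: "'i \<Rightarrow> 'a \<Rightarrow> 'g"
  defines "P \<equiv> top_of_set ((\<Union>i\<in>I. U i) \<times> (UNIV :: 'g set))"
    and "act \<equiv> \<lambda>p g. (fst p, snd p \<otimes> g)" and "h \<equiv> \<lambda>i p. inv (\<psi> i (fst p)) \<otimes> snd p"
  assumes S: "atlas H S" and U: "\<And>i. i \<in> I \<Longrightarrow> open (U i)" 
    and \<psi>: "\<And>i. i \<in> I \<Longrightarrow> holomorphic_map S A (U i) (\<psi> i)"
  shows "holomorphic_principal_bundle G A S (\<Union>i\<in>I. U i) P fst act ((\<lambda>i. (U i, h i)) ` I)"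
    and "transition_function G P fst (U i, h i) (U j, h j) (\<lambda>x. inv (\<psi> i x) \<otimes> \<psi> j x)"
proof -
  have trans: "transition_function G P fst (U i, h i) (U j, h j) (\<lambda>x. inv (\<psi> i x) \<otimes> \<psi> j x)" for i j
  proof -
    have "\<psi> j x \<otimes> (inv (\<psi> j x) \<otimes> g) = g" for x g by (simp flip: m_assoc)
    then show ?thesis by (simp add: transition_function_def h_def m_assoc)
  qed
  then show "transition_function G P fst (U i, h i) (U j, h j) (\<lambda>x. inv (\<psi> i x) \<otimes> \<psi> j x)" .
  have triv: "local_trivialisation G (\<Union>i\<in>I. U i) P fst act (U i, h i)" if i: "i \<in> I" for i
    unfolding local_trivialisation_def prod.case
  proof (intro conjI ballI allI impI)
    let ?D = "U i \<times> (UNIV :: 'g set)"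
    have cont: "continuous_on ?D (\<lambda>p. \<psi> i (fst p))"
      by (rule continuous_on_compose2[of "U i" "\<psi> i"]) 
         (use \<psi>[OF i] in \<open>auto simp: holomorphic_map_def intro: continuous_intros\<close>)
    have mult: "continuous_on ?D (\<lambda>p. f p \<otimes> snd p)" if "continuous_on ?D f" for f
      using continuous_on_compose2[OF continuous_mult continuous_on_Pair[OF that continuous_on_snd[OF continuous_on_id]]]
      by simp
    have "continuous_on ?D (\<lambda>p. inv (\<psi> i (fst p)))"
      by (rule continuous_on_compose2[OF continuous_inverse cont]) simp
    then have c1: "continuous_on ?D (\<lambda>p. (fst p, h i p))"
      unfolding h_def by (intro continuous_on_Pair mult continuous_on_fst continuous_on_id)
    \<comment> \<open>The inverse of the trivialisation:
      \<open>(x, g) \<mapsto> (x, \<psi>\<^sub>i(x) g)\<close>.\<close>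
    have c2: "continuous_on ?D (\<lambda>p. (fst p, \<psi> i (fst p) \<otimes> snd p))"
      by (intro continuous_on_Pair mult continuous_on_fst continuous_on_id cont)
    have X: "subtopology P {p \<in> topspace P. fst p \<in> U i} = top_of_set ?D"
    proof -
      have "((\<Union>i\<in>I. U i) \<times> UNIV) \<inter> {p \<in> topspace P. fst p \<in> U i} = ?D"
        using i by (auto simp: P_def)
      then show ?thesis by (simp add: P_def subtopology_subtopology)
    qed
    have Y: "prod_topology (top_of_set (U i)) (euclidean :: 'g topology) = top_of_set ?D"
      by (metis prod_topology_subtopology_eu subtopology_UNIV)
    have "homeomorphic_maps (top_of_set ?D) (top_of_set ?D) (\<lambda>p. (fst p, h i p)) 
        (\<lambda>p. (fst p, \<psi> i (fst p) \<otimes> snd p))"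
      unfolding homeomorphic_maps_def
      using c1 c2 by (auto simp: h_def simp flip: m_assoc)
    then show "homeomorphic_map (subtopology P {p \<in> topspace P. fst p \<in> U i})
       (prod_topology (top_of_set (U i)) euclidean) (\<lambda>p. (fst p, h i p))"
      unfolding X Y homeomorphic_map_maps by blast
  qed (use U i in \<open>auto simp: act_def h_def m_assoc\<close>)
  have coc: "holomorphic_map S A (U i \<inter> U j) (\<lambda>x. inv (\<psi> i x) \<otimes> \<psi> j x)" if "i \<in> I" "j \<in> I" for i j
    by (rule conjunct1[OF holomorphic_cocycle_quotients[OF S U \<psi>, unfolded holomorphic_cocycle_def], 
          rule_format, OF _ _ that])
  show "holomorphic_principal_bundle G A S (\<Union>i\<in>I. U i) P fst act ((\<lambda>i. (U i, h i)) ` I)"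
    unfolding holomorphic_principal_bundle_def
  proof (intro conjI)
    show "continuous_map P (top_of_set (\<Union>i\<in>I. U i)) fst"
      by (auto simp: P_def intro: continuous_on_fst continuous_on_id)
    show "\<forall>t\<in>(\<lambda>i. (U i, h i)) ` I. local_trivialisation G (\<Union>i\<in>I. U i) P fst act t"
      using triv by blast
    show "\<forall>s\<in>(\<lambda>i. (U i, h i)) ` I. \<forall>t\<in>(\<lambda>i. (U i, h i)) ` I. 
       \<exists>f. holomorphic_map S A (fst s \<inter> fst t) f \<and> transition_function G P fst s t f"
    proof (intro ballI)
      fix s t assume "s \<in> (\<lambda>i. (U i, h i)) ` I" "t \<in> (\<lambda>i. (U i, h i)) ` I"
      then obtain i j where ij: "i \<in> I" "j \<in> I" "s = (U i, h i)" "t = (U j, h j)" by blast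
      show "\<exists>f. holomorphic_map S A (fst s \<inter> fst t) f \<and> transition_function G P fst s t f"
        unfolding ij(3,4) fst_conv using coc[OF ij(1,2)] trans[of i j] by blast
    qed
  qed (auto simp: P_def act_def m_assoc)
qed

end

theorem proposition4p3:
  fixes G :: "'g::t2_space monoid"
    and AK :: "('g, complex^'n) chart set"
    and AS :: "('a::t2_space, complex) chart set"
    and p :: "nat \<Rightarrow> 'a" and k :: nat
    and U :: "'i \<Rightarrow> 'a set" and I :: "'i set"
    and lam :: complex and \<xi> :: "('a, complex^'n) one_form"
  defines "M \<equiv> UNIV - p ` {1..k}"
  assumes "complex_lie_group G AK"
    and "connected (UNIV :: 'g set)" and "simply_connected (UNIV :: 'g set)"
    and "simple_lie_algebra (lie_bracket G AK)"
    and "riemann_surface AS"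
    and "compact (UNIV :: 'a set)" and "connected (UNIV :: 'a set)"
    and "k \<ge> 1" and "inj_on p {1..k}"
    and "good_open_cover M I U"
    and "(lam, \<xi>) \<in> operator_hyperplane AS M lam"
  shows
    "(lam \<noteq> 0 \<longrightarrow> (\<forall>i\<in>I. \<exists>\<psi>. is_solution G AK AS lam \<xi> (U i) \<psi>)) \<and>
     (\<forall>\<psi> \<phi>. (\<forall>i\<in>I. is_solution G AK AS lam \<xi> (U i) (\<psi> i)) \<and>
            \<phi> = (\<lambda>i j x. inv\<^bsub>G\<^esub> (\<psi> i x) \<otimes>\<^bsub>G\<^esub> \<psi> j x) \<longrightarrow>
        holomorphic_cocycle G AK AS I U \<phi> \<and>
        (lam \<noteq> 0 \<longrightarrow> (\<forall>i\<in>I. \<forall>j\<in>I. \<phi> i j constant_on (U i \<inter> U j))) \<and>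
        (\<exists>(P :: ('a \<times> 'g) topology) \<pi> act h.
           holomorphic_principal_bundle G AK AS M P \<pi> act ((\<lambda>i. (U i, h i)) ` I) \<and>
           (\<forall>i\<in>I. \<forall>j\<in>I. transition_function G P \<pi> (U i, h i) (U j, h j) (\<phi> i j)) \<and>
           (lam \<noteq> 0 \<longrightarrow> flat_bundle G AK AS M P \<pi> act ((\<lambda>i. (U i, h i)) ` I))))"
proof -
  interpret complex_lie_group G AK by fact
  note at = riemann_surface.holomorphic_atlas[OF \<open>riemann_surface AS\<close>]
  have U: "\<And>i. i \<in> I \<Longrightarrow> open (U i)" and M: "(\<Union>i\<in>I. U i) = M"
    and contr: "\<And>J. J \<subseteq> I \<Longrightarrow> finite J \<Longrightarrow> J \<noteq> {} \<Longrightarrow> (\<Inter>j\<in>J. U j) \<noteq> {} \<Longrightarrow> contractible (\<Inter>j\<in>J. U j)"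
    using \<open>good_open_cover M I U\<close> unfolding good_open_cover_def by blast+
  \<comment> \<open>The case \<open>i = j\<close> supplies contractibility of each single nonempty
    \<open>U i\<close>.\<close>
  have contr2: "contractible (U i \<inter> U j)" if "i \<in> I" "j \<in> I" "U i \<inter> U j \<noteq> {}" for i j
    using contr[of "{i, j}"] that by simp
  have \<xi>: "\<xi> \<in> holomorphic_one_forms AS M"
    using \<open>(lam, \<xi>) \<in> operator_hyperplane AS M lam\<close> by (simp add: operator_hyperplane_def)
  have exists: "\<exists>\<psi>. is_solution G AK AS lam \<xi> (U i) \<psi>" if "lam \<noteq> 0" "i \<in> I" for i
  \<comment> \<open>A good cover may have empty members, about which contractibility says nothing;
    on the empty set every function is a solution.\<close>
  proof (cases "U i = {}")
    case True
    then show ?thesis by (simp add: is_solution_def holomorphic_map_def holomorphic_on_def)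
  next
    case False
    show ?thesis
    proof (rule solution_ex_contractible[OF \<open>riemann_surface AS\<close> \<xi> that(1) U[OF that(2)]])
      show "U i \<subseteq> M" using M that(2) by blast
      show "contractible (U i)" using contr2[of i i] that(2) False by simp
    qed
  qed
  have main: "holomorphic_cocycle G AK AS I U \<phi> \<and>
        (lam \<noteq> 0 \<longrightarrow> (\<forall>i\<in>I. \<forall>j\<in>I. \<phi> i j constant_on (U i \<inter> U j))) \<and>
        (\<exists>(P :: ('a \<times> 'g) topology) \<pi> act h.
           holomorphic_principal_bundle G AK AS M P \<pi> act ((\<lambda>i. (U i, h i)) ` I) \<and>
           (\<forall>i\<in>I. \<forall>j\<in>I. transition_function G P \<pi> (U i, h i) (U j, h j) (\<phi> i j)) \<and>
           (lam \<noteq> 0 \<longrightarrow> flat_bundle G AK AS M P \<pi> act ((\<lambda>i. (U i, h i)) ` I)))"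
    if sol: "\<forall>i\<in>I. is_solution G AK AS lam \<xi> (U i) (\<psi> i)"
      and \<phi>: "\<phi> = (\<lambda>i j x. inv\<^bsub>G\<^esub> (\<psi> i x) \<otimes>\<^bsub>G\<^esub> \<psi> j x)" for \<psi> \<phi>
  proof -
    have hol: "\<And>i. i \<in> I \<Longrightarrow> holomorphic_map AS AK (U i) (\<psi> i)"
      using sol by (simp add: is_solution_def)
    have const: "\<phi> i j constant_on (U i \<inter> U j)" if "lam \<noteq> 0" and i: "i \<in> I" and j: "j \<in> I" for i j
    proof (cases "U i \<inter> U j = {}")
      case True
      then show ?thesis by (simp add: constant_on_def)
    next
      case False
      have conn: "connected (U i \<inter> U j)"
        by (rule contractible_imp_connected_set[OF contr2[OF i j False]])
      have "\<phi> i j x = \<phi> i j y" if "x \<in> U i \<inter> U j" "y \<in> U i \<inter> U j" for x y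
      proof (rule connected_local_const[OF conn that], rule ballI)
        fix a assume a: "a \<in> U i \<inter> U j"
        have "is_solution G AK AS lam \<xi> (U i) (\<psi> i)" "is_solution G AK AS lam \<xi> (U j) (\<psi> j)"
          using sol i j by blast+
        from solution_quotient_locally_constant[OF at U[OF i] U[OF j] \<open>lam \<noteq> 0\<close> this a]
        obtain N where N: "open N" "a \<in> N" 
          "\<forall>y\<in>N. inv\<^bsub>G\<^esub> (\<psi> i y) \<otimes>\<^bsub>G\<^esub> \<psi> j y = inv\<^bsub>G\<^esub> (\<psi> i a) \<otimes>\<^bsub>G\<^esub> \<psi> j a"
          by (elim exE conjE) (rule that)
        have "\<phi> i j a = \<phi> i j b" if "b \<in> N" for b
          using bspec[OF N(3) that] unfolding \<phi> by (rule sym)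
        then show "\<forall>\<^sub>F b in at a within U i \<inter> U j. \<phi> i j a = \<phi> i j b"
          unfolding eventually_at_topological using N(1,2) by blast
      qed
      then show ?thesis unfolding constant_on_def by blast
    qed
    let ?P = "top_of_set ((\<Union>i\<in>I. U i) \<times> (UNIV :: 'g set))"
    let ?act = "\<lambda>p g. (fst p, snd p \<otimes>\<^bsub>G\<^esub> g)"
    let ?h = "\<lambda>i p. inv\<^bsub>G\<^esub> (\<psi> i (fst p)) \<otimes>\<^bsub>G\<^esub> snd p"
    let ?T = "(\<lambda>i. (U i, ?h i)) ` I"
    have pb: "holomorphic_principal_bundle G AK AS M ?P fst ?act ?T"
      unfolding M[symmetric] by (rule principal_bundle_of_quotients(1)[OF at U hol])
    have trans: "transition_function G ?P fst (U i, ?h i) (U j, ?h j) (\<phi> i j)" for i j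
      unfolding \<phi> by (rule principal_bundle_of_quotients(2)[OF at U hol])
    have flat: "flat_bundle G AK AS M ?P fst ?act ?T" if "lam \<noteq> 0"
      unfolding flat_bundle_def
    \<comment> \<open>The given trivialisations already have constant transition functions, so they
      serve as their own flat atlas.\<close>
    proof (intro exI[of _ ?T] conjI ballI)
      show "holomorphic_principal_bundle G AK AS M ?P fst ?act (?T \<union> ?T)" using pb by simp
      show "(\<Union>t\<in>?T. fst t) = M" using M by simp
      fix s t assume "s \<in> ?T" "t \<in> ?T"
      then obtain i j where ij: "i \<in> I" "j \<in> I" "s = (U i, ?h i)" "t = (U j, ?h j)" by blast
      have "locally_constant_on (\<phi> i j) (U i \<inter> U j)"
        using const[OF that ij(1,2)] unfolding locally_constant_on_def
        by (intro ballI exI[of _ UNIV]) simp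
      then show "\<exists>f. locally_constant_on f (fst s \<inter> fst t) \<and> transition_function G ?P fst s t f"
        unfolding ij(3,4) fst_conv using trans[of i j] by blast
    qed
    show ?thesis
    proof (intro conjI impI)
      show "holomorphic_cocycle G AK AS I U \<phi>"
        unfolding \<phi> by (rule holomorphic_cocycle_quotients[OF at U hol])
      show "\<forall>i\<in>I. \<forall>j\<in>I. \<phi> i j constant_on (U i \<inter> U j)" if "lam \<noteq> 0"
        using const[OF that] by blast
      show "\<exists>(P :: ('a \<times> 'g) topology) \<pi> act h.
           holomorphic_principal_bundle G AK AS M P \<pi> act ((\<lambda>i. (U i, h i)) ` I) \<and>
           (\<forall>i\<in>I. \<forall>j\<in>I. transition_function G P \<pi> (U i, h i) (U j, h j) (\<phi> i j)) \<and>
           (lam \<noteq> 0 \<longrightarrow> flat_bundle G AK AS M P \<pi> act ((\<lambda>i. (U i, h i)) ` I))"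
        by (rule exI[of _ ?P], rule exI[of _ fst], rule exI[of _ ?act], rule exI[of _ ?h],
            intro conjI ballI impI pb trans flat)
    qed
  qed
  show ?thesis
  proof (rule conjI; intro allI impI ballI)
    show "\<exists>\<psi>. is_solution G AK AS lam \<xi> (U i) \<psi>" if "lam \<noteq> 0" "i \<in> I" for i
      using that by (rule exists)
  qed (elim conjE, rule main)
qed

end
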